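(* Let $(V_1,d_1)$ and $(V_2,d_2)$ be finite (extended) metric spaces and let $\gamma_i\colon V_i\to[0,\infty]$ be functions for $i=1,2$. Define the graphs $G_{\gamma_i}\colon V_i\times V_i\to[0,\infty]^2$ by $G_{\gamma_i}(v,v')=(d_i(v,v'),\gamma_i(v))$. Then $$d_{\mathcal{N}}^+(G_{\gamma_1},G_{\gamma_2})=\inf_{C\in\mathcal{C}(V_1,V_2)}\max\left\{\sup_{(v_1,v_2),(v_1',v_2')\in C}\vert d_1(v_1,v_1')-d_2(v_2,v_2')\vert,\ \sup_{(v_1,v_2)\in C}\vert\gamma_1(v_1)-\gamma_2(v_2)\vert\right\},$$ and for every $n\geq 0$ the interleaving distance $d_I^+\big(H_n(R^\bullet_{\sup}(G_{\gamma_1})),H_n(R^\bullet_{\sup}(G_{\gamma_2}))\big)$ is bounded above by this quantity.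
   Context: An extended metric is a metric allowed to take the value $\infty$. For $a,b\in[0,\infty]$, $|a-b|$ has the convention $|\infty-\infty|=0$. Let $L=[0,\infty]^2$ with the product order, coordinatewise addition $+$, and binary supremum $\sup$ (coordinatewise maximum). The modules $H_n(R^\bullet_{\sup}(G_{\gamma_i}))$ defined below are isomorphic to the persistent homology modules of the sublevel Rips bifiltrations of $\gamma_i$, whose simplices in degree $(t,s)$ are the nonempty $\sigma\subseteq V_i$ with $\gamma_i(v)\le s$ and $d_i(v,v')\le t$ for all $v,v'\in\sigma$. A correspondence between $V_1$ and $V_2$ is a subset $C\subseteq V_1\times V_2$ such that both projection maps $\pi_i\colon C\to V_i$ are surjective; $\mathcal{C}(V_1,V_2)$ is the collection of all correspondences. An $L$-graph is a function $G\colon V\times V\to L$ with $V$ finite. For $f\colon X\to V$ with $X$ finite, $f^*G(x,x')=G(f(x),f(x'))$. For $L$-graphs $G,G'$ on the same vertex set $V$, $\vec{\delta}_+(G,G')=\sup_{v,v'\in V}\inf\{c\in L\mid G'(v,v')\leq G(v,v')+c\}$ and $\delta_+(G,G')=\sup\{\vec{\delta}_+(G,G'),\vec{\delta}_+(G',G)\}\in L$. For $L$-graphs $G_1,G_2$ with vertex sets $V_1,V_2$, the generalized network distance is $d^+_{\mathcal{N}}(G_1,G_2)=\inf_{C\in\mathcal{C}(V_1,V_2)}\operatorname{sup}(\delta_+(\pi_1^*G_1,\pi_2^*G_2))\in[0,\infty]$, where $\operatorname{sup}\colon[0,\infty]^2\to[0,\infty]$ is $(a,b)\mapsto\sup\{a,b\}$.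 For an $L$-graph $G$ and $(v_0,\dots,v_n)\in V^{n+1}$, set $\mathcal{L}^G_{\sup}(v_0,\dots,v_n)=G(v_0,v_0)$ if all $v_i$ are equal, and otherwise $\mathcal{L}^G_{\sup}(v_0,\dots,v_n)=\sup\{G(v_{i-1},v_i)\mid 1\leq i\leq n,\ v_{i-1}\neq v_i\}$. For order-preserving $\alpha\colon[m]\to[n]$, where $[k]=\{0,\dots,k\}$, and $y=(v_0,\dots,v_n)$, write $\alpha^*y=(v_{\alpha(0)},\dots,v_{\alpha(m)})$. For $t\in L$, $R^t_{\sup}(G)$ is the simplicial set whose $n$-simplices are the $y\in V^{n+1}$ with $\mathcal{L}^G_{\sup}(\alpha^*y)\leq t$ for all $m\geq0$ and all order-preserving $\alpha\colon[m]\to[n]$, with structure maps $y\mapsto\alpha^*y$. Fix a field $\mathbb{K}$. $H_n(R^\bullet_{\sup}(G))$ is the functor $t\mapsto H_n(R^t_{\sup}(G);\mathbb{K})$ from the poset $L$ to $\mathbb{K}$-vector spaces (an $L$-persistence module), with structure maps induced by inclusions. For $\delta\in L$, two $L$-persistence modules $H,H'$ are $\delta$-interleaved (with respect to $+$) if there are linear maps $F_t\colon H_t\to H'_{t+\delta}$ and $G_t\colon H'_t\to H_{t+\delta}$, $t\in L$, commuting with structure maps, such that $G_{t+\delta}\circ F_t$ and $F_{t+\delta}\circ G_t$ are the structure maps $H_t\to H_{t+2\delta}$ and $H'_t\to H'_{t+2\delta}$. The interleaving distance is $d_I^+(H,H')=\inf\{\epsilon\in[0,\infty]\mid H,H'\text{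 are }(\epsilon,\epsilon)\text{-interleaved}\}$, where here $(\epsilon,\epsilon)\in L$ is regarded as a single element $\delta$. *)

theory Defs
  imports
    "HOL-Library.Extended_Nonnegative_Real"
    "HOL-Library.Product_Order"
    "HOL-Library.Product_Plus"
    "HOL-Library.Poly_Mapping"
    "HOL-Algebra.AbelCoset"
    "Jordan_Normal_Form.VS_Connect"
begin

section \<open>Extended metrics and $L$-graphs\<close>

text \<open>
  The lattice \<open>L = [0, \<infinity>]\<^sup>2\<close>. Order, suprema, infima and addition are the coordinatewise ones
  from \<^theory>\<open>HOL-Library.Product_Order\<close> and \<^theory>\<open>HOL-Library.Product_Plus\<close>.
\<close>

type_synonym L = "ennreal \<times> ennreal"

definition extended_metric_on :: "'v set \<Rightarrow> ('v \<Rightarrow> 'v \<Rightarrow> ennreal) \<Rightarrow> bool" where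
  "extended_metric_on V d \<longleftrightarrow>
     (\<forall>x\<in>V. \<forall>y\<in>V. d x y = 0 \<longleftrightarrow> x = y) \<and>
     (\<forall>x\<in>V. \<forall>y\<in>V. d x y = d y x) \<and>
     (\<forall>x\<in>V. \<forall>y\<in>V. \<forall>z\<in>V. d x z \<le> d x y + d y z)"

text \<open>
  Subtraction on \<^typ>\<open>ennreal\<close> truncates at \<open>0\<close> and satisfies \<open>\<infinity> - \<infinity> = \<infinity>\<close>, so the convention
  \<open>\<bar>\<infinity> - \<infinity>\<bar> = 0\<close> needs a case of its own.
\<close>

definition absdiff :: "ennreal \<Rightarrow> ennreal \<Rightarrow> ennreal" where
  "absdiff a b = (if a = \<infinity> \<and> b = \<infinity> then 0 else if a \<le> b then b - a else a - b)"

definition correspondences :: "'v set \<Rightarrow> 'w set \<Rightarrow> ('v \<times> 'w) set set" where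
  "correspondences V W = {C. C \<subseteq> V \<times> W \<and> fst ` C = V \<and> snd ` C = W}"

text \<open>
  An \<open>L\<close>-graph is a function \<open>G :: 'v \<Rightarrow> 'v \<Rightarrow> L\<close> together with a finite vertex set \<open>V :: 'v set\<close>
  that is passed separately; only the values of \<open>G\<close> on \<open>V\<close> matter.
\<close>

definition pullback :: "('x \<Rightarrow> 'v) \<Rightarrow> ('v \<Rightarrow> 'v \<Rightarrow> L) \<Rightarrow> 'x \<Rightarrow> 'x \<Rightarrow> L" where
  "pullback f G x x' = G (f x) (f x')"

definition dir_delta_plus :: "'v set \<Rightarrow> ('v \<Rightarrow> 'v \<Rightarrow> L) \<Rightarrow> ('v \<Rightarrow> 'v \<Rightarrow> L) \<Rightarrow> L" where
  "dir_delta_plus V G G' = (SUP (v, v') \<in> V \<times> V. Inf {c. G' v v' \<le> G v v' + c})"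

definition delta_plus :: "'v set \<Rightarrow> ('v \<Rightarrow> 'v \<Rightarrow> L) \<Rightarrow> ('v \<Rightarrow> 'v \<Rightarrow> L) \<Rightarrow> L" where
  "delta_plus V G G' = sup (dir_delta_plus V G G') (dir_delta_plus V G' G)"

definition sup_coords :: "L \<Rightarrow> ennreal" where
  "sup_coords p = sup (fst p) (snd p)"

definition network_dist ::
    "'v set \<Rightarrow> ('v \<Rightarrow> 'v \<Rightarrow> L) \<Rightarrow> 'w set \<Rightarrow> ('w \<Rightarrow> 'w \<Rightarrow> L) \<Rightarrow> ennreal" where
  "network_dist V G W G' =
     (INF C \<in> correspondences V W. sup_coords (delta_plus C (pullback fst G) (pullback snd G')))"

definition function_graph :: "('v \<Rightarrow> 'v \<Rightarrow> ennreal) \<Rightarrow> ('v \<Rightarrow> ennreal) \<Rightarrow> 'v \<Rightarrow> 'v \<Rightarrow> L" where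
  "function_graph d \<gamma> v v' = (d v v', \<gamma> v)"

section \<open>Simplicial sets and their homology\<close>

text \<open>
  For an order-preserving \<open>\<alpha> : [m] \<rightarrow> [n]\<close>, \<open>pull X m n \<alpha>\<close> is the structure map
  \<open>\<alpha>\<^sup>* : X\<^sub>n \<rightarrow> X\<^sub>m\<close>.
\<close>

record 'x sset =
  simplices :: "nat \<Rightarrow> 'x set"
  pull :: "nat \<Rightarrow> nat \<Rightarrow> (nat \<Rightarrow> nat) \<Rightarrow> 'x \<Rightarrow> 'x"

definition order_preserving :: "nat \<Rightarrow> nat \<Rightarrow> (nat \<Rightarrow> nat) \<Rightarrow> bool" where
  "order_preserving m n \<alpha> \<longleftrightarrow> \<alpha> ` {0..m} \<subseteq> {0..n} \<and> mono_on {0..m} \<alpha>"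

locale simplicial_set =
  fixes X :: "'x sset"
  assumes pull_closed:
      "order_preserving m n \<alpha> \<Longrightarrow> x \<in> simplices X n \<Longrightarrow> pull X m n \<alpha> x \<in> simplices X m"
    and pull_cong:
      "order_preserving m n \<alpha> \<Longrightarrow> (\<And>i. i \<le> m \<Longrightarrow> \<alpha> i = \<beta> i) \<Longrightarrow> x \<in> simplices X n \<Longrightarrow>
         pull X m n \<alpha> x = pull X m n \<beta> x"
    and pull_id: "x \<in> simplices X n \<Longrightarrow> pull X n n (\<lambda>i. i) x = x"
    and pull_comp:
      "order_preserving l m \<alpha> \<Longrightarrow> order_preserving m n \<beta> \<Longrightarrow> x \<in> simplices X n \<Longrightarrow>
         pull X l n (\<lambda>i. \<beta> (\<alpha> i)) x = pull X l m \<alpha> (pull X m n \<beta> x)"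

definition coface :: "nat \<Rightarrow> nat \<Rightarrow> nat" where
  "coface i k = (if k < i then k else Suc k)"

text \<open>
  The \<open>K\<close>-vector space with basis the \<open>n\<close>-simplices. Vector spaces are records for the locale
  \<^locale>\<open>vectorspace\<close>, in which \<open>mult\<close> and \<open>one\<close> play no role; the field is the type \<^typ>\<open>'k\<close>,
  seen as the ring record \<open>class_ring\<close>.
\<close>

definition chains :: "'x sset \<Rightarrow> nat \<Rightarrow> ('k::field, 'x \<Rightarrow>\<^sub>0 'k) module" where
  "chains X n =
     \<lparr>carrier = {c. Poly_Mapping.keys c \<subseteq> simplices X n}, mult = undefined, one = undefined,
      zero = 0, add = (+), smult = (\<lambda>a. Poly_Mapping.map ((*) a))\<rparr>"

definition boundary :: "'x sset \<Rightarrow> nat \<Rightarrow> ('x \<Rightarrow>\<^sub>0 'k::field) \<Rightarrow> ('x \<Rightarrow>\<^sub>0 'k)" where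
  "boundary X n c =
     (if n = 0 then 0
      else \<Sum>\<sigma>\<in>Poly_Mapping.keys c. \<Sum>i\<le>n.
             Poly_Mapping.single (pull X (n - 1) n (coface i) \<sigma>)
               ((-1) ^ i * Poly_Mapping.lookup c \<sigma>))"

definition cycles :: "'x sset \<Rightarrow> nat \<Rightarrow> ('x \<Rightarrow>\<^sub>0 'k::field) set" where
  "cycles X n = {c \<in> carrier (chains X n). boundary X n c = 0}"

definition boundaries :: "'x sset \<Rightarrow> nat \<Rightarrow> ('x \<Rightarrow>\<^sub>0 'k::field) set" where
  "boundaries X n = boundary X (Suc n) ` carrier (chains X (Suc n))"

definition quotient_module :: "('k, 'm) module \<Rightarrow> 'm set \<Rightarrow> ('k, 'm set) module" where
  "quotient_module M B =
     \<lparr>carrier = a_rcosets\<^bsub>M\<^esub> B, mult = undefined, one = undefined, zero = B, add = (<+>\<^bsub>M\<^esub>),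
      smult = (\<lambda>a A. \<Union>x\<in>A. B +>\<^bsub>M\<^esub> (a \<odot>\<^bsub>M\<^esub> x))\<rparr>"

definition homology :: "'x sset \<Rightarrow> nat \<Rightarrow> ('k::field, ('x \<Rightarrow>\<^sub>0 'k) set) module" where
  "homology X n = quotient_module ((chains X n)\<lparr>carrier := cycles X n\<rparr>) (boundaries X n)"

definition chain_map :: "('x \<Rightarrow> 'y) \<Rightarrow> ('x \<Rightarrow>\<^sub>0 'k::field) \<Rightarrow> ('y \<Rightarrow>\<^sub>0 'k)" where
  "chain_map f c = (\<Sum>\<sigma>\<in>Poly_Mapping.keys c. Poly_Mapping.single (f \<sigma>) (Poly_Mapping.lookup c \<sigma>))"

text \<open>The map \<open>H\<^sub>n(X) \<rightarrow> H\<^sub>n(Y)\<close> induced by a simplicial map \<open>f\<close>, on cosets of boundaries.\<close>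

definition homology_map ::
    "'y sset \<Rightarrow> nat \<Rightarrow> ('x \<Rightarrow> 'y) \<Rightarrow> ('x \<Rightarrow>\<^sub>0 'k::field) set \<Rightarrow> ('y \<Rightarrow>\<^sub>0 'k) set" where
  "homology_map Y n f A = (\<Union>z\<in>A. boundaries Y n +>\<^bsub>chains Y n\<^esub> chain_map f z)"

section \<open>The Rips construction of an $L$-graph\<close>

text \<open>A tuple \<open>(v\<^sub>0, \<dots>, v\<^sub>n)\<close> is a list of length \<open>n + 1\<close>.\<close>

definition path_sup :: "('v \<Rightarrow> 'v \<Rightarrow> L) \<Rightarrow> 'v list \<Rightarrow> L" where
  "path_sup G y =
     (if \<forall>i<length y. y ! i = y ! 0 then G (y ! 0) (y ! 0)
      else SUP i \<in> {i. 1 \<le> i \<and> i < length y \<and> y ! (i - 1) \<noteq> y ! i}. G (y ! (i - 1)) (y ! i))"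

definition pull_tuple :: "nat \<Rightarrow> (nat \<Rightarrow> nat) \<Rightarrow> 'v list \<Rightarrow> 'v list" where
  "pull_tuple m \<alpha> y = map (\<lambda>i. y ! \<alpha> i) [0..<Suc m]"

definition rips :: "'v set \<Rightarrow> ('v \<Rightarrow> 'v \<Rightarrow> L) \<Rightarrow> L \<Rightarrow> 'v list sset" where
  "rips V G t =
     \<lparr>simplices = (\<lambda>n. {y. length y = Suc n \<and> set y \<subseteq> V \<and>
        (\<forall>m \<alpha>. order_preserving m n \<alpha> \<longrightarrow> path_sup G (pull_tuple m \<alpha> y) \<le> t)}),
      pull = (\<lambda>m n \<alpha>. pull_tuple m \<alpha>)\<rparr>"

section \<open>Persistence modules and interleavings\<close>

record ('k, 'm) pers_module =
  pspace :: "L \<Rightarrow> ('k, 'm) module"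
  pmap :: "L \<Rightarrow> L \<Rightarrow> 'm \<Rightarrow> 'm"

locale persistence_module =
  fixes H :: "('k::field, 'm) pers_module"
  assumes pmap_linear: "s \<le> t \<Longrightarrow> linear_map class_ring (pspace H s) (pspace H t) (pmap H s t)"
    and pmap_id: "x \<in> carrier (pspace H t) \<Longrightarrow> pmap H t t x = x"
    and pmap_comp: "r \<le> s \<Longrightarrow> s \<le> t \<Longrightarrow> x \<in> carrier (pspace H r) \<Longrightarrow>
      pmap H s t (pmap H r s x) = pmap H r t x"

definition rips_homology ::
    "'k::field itself \<Rightarrow> nat \<Rightarrow> 'v set \<Rightarrow> ('v \<Rightarrow> 'v \<Rightarrow> L) \<Rightarrow> ('k, ('v list \<Rightarrow>\<^sub>0 'k) set) pers_module" where
  "rips_homology K n V G =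
     \<lparr>pspace = (\<lambda>t. homology (rips V G t) n),
      pmap = (\<lambda>s t. homology_map (rips V G t) n (\<lambda>y. y))\<rparr>"

definition pers_hom ::
    "L \<Rightarrow> ('k::field, 'm) pers_module \<Rightarrow> ('k, 'm') pers_module \<Rightarrow> (L \<Rightarrow> 'm \<Rightarrow> 'm') \<Rightarrow> bool" where
  "pers_hom \<delta> H H' F \<longleftrightarrow>
     (\<forall>t. linear_map class_ring (pspace H t) (pspace H' (t + \<delta>)) (F t)) \<and>
     (\<forall>s t. s \<le> t \<longrightarrow> (\<forall>x\<in>carrier (pspace H s).
        F t (pmap H s t x) = pmap H' (s + \<delta>) (t + \<delta>) (F s x)))"

definition interleaved ::
    "L \<Rightarrow> ('k::field, 'm) pers_module \<Rightarrow> ('k, 'm') pers_module \<Rightarrow> bool" where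
  "interleaved \<delta> H H' \<longleftrightarrow>
     (\<exists>F G. pers_hom \<delta> H H' F \<and> pers_hom \<delta> H' H G \<and>
        (\<forall>t. \<forall>x\<in>carrier (pspace H t). G (t + \<delta>) (F t x) = pmap H t (t + \<delta> + \<delta>) x) \<and>
        (\<forall>t. \<forall>x\<in>carrier (pspace H' t). F (t + \<delta>) (G t x) = pmap H' t (t + \<delta> + \<delta>) x))"

definition interleaving_dist ::
    "('k::field, 'm) pers_module \<Rightarrow> ('k, 'm') pers_module \<Rightarrow> ennreal" where
  "interleaving_dist H H' = Inf {\<epsilon>. interleaved (\<epsilon>, \<epsilon>) H H'}"

section \<open>Well-definedness\<close>

text \<open>
  The remaining facts show that \<^const>\<open>rips\<close> is a simplicial set and that
  \<^const>\<open>rips_homology\<close> is a persistence module.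
\<close>

lemma order_preserving_compose:
  "order_preserving l m \<beta> \<Longrightarrow> order_preserving m n \<alpha> \<Longrightarrow> order_preserving l n (\<lambda>i. \<alpha> (\<beta> i))"
  unfolding order_preserving_def mono_on_def image_subset_iff by auto

lemma order_preserving_le: "order_preserving m n \<alpha> \<Longrightarrow> i \<le> m \<Longrightarrow> \<alpha> i \<le> n"
  unfolding order_preserving_def by (simp add: image_subset_iff)

lemma order_preserving_coface: "order_preserving n (Suc n) (coface i)"
  unfolding order_preserving_def coface_def mono_on_def by auto

lemma pull_tuple_nth: "i \<le> m \<Longrightarrow> pull_tuple m \<alpha> y ! i = y ! \<alpha> i"
  unfolding pull_tuple_def by (simp del: upt_Suc)

lemma pull_tuple_compose:
  "order_preserving l m \<beta> \<Longrightarrow> pull_tuple l \<beta> (pull_tuple m \<alpha> y) = pull_tuple l (\<lambda>i. \<alpha> (\<beta> i)) y"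
  unfolding pull_tuple_def[of l] by (simp add: pull_tuple_nth order_preserving_le del: upt_Suc)

lemma simplicial_set_rips: "simplicial_set (rips V G t)"
proof
  fix m n \<alpha> x
  assume a: "order_preserving m n \<alpha>" "x \<in> simplices (rips V G t) n"
  have "set (pull_tuple m \<alpha> x) \<subseteq> V"
  proof
    fix v assume "v \<in> set (pull_tuple m \<alpha> x)"
    then obtain i where "i \<le> m" "v = x ! \<alpha> i" by (force simp: pull_tuple_def less_Suc_eq_le simp del: upt_Suc)
    then show "v \<in> V" using a order_preserving_le[OF a(1)]
      by (force simp: rips_def less_Suc_eq_le)
  qed
  then show "pull (rips V G t) m n \<alpha> x \<in> simplices (rips V G t) m"
    using a by (auto simp: rips_def pull_tuple_compose order_preserving_compose)
       (simp add: pull_tuple_def)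
next
  fix m n \<alpha> \<beta> x
  assume "order_preserving m n \<alpha>" "\<And>i. i \<le> m \<Longrightarrow> \<alpha> i = \<beta> i" "x \<in> simplices (rips V G t) n"
  then show "pull (rips V G t) m n \<alpha> x = pull (rips V G t) m n \<beta> x"
    by (simp add: rips_def pull_tuple_def)
next
  fix n x assume "x \<in> simplices (rips V G t) n"
  then show "pull (rips V G t) n n (\<lambda>i. i) x = x"
    by (auto simp: rips_def pull_tuple_def intro!: nth_equalityI simp del: upt_Suc)
next
  fix l m n \<alpha> \<beta> x
  assume "order_preserving l m \<alpha>"
  then show "pull (rips V G t) l n (\<lambda>i. \<beta> (\<alpha> i)) x = pull (rips V G t) l m \<alpha> (pull (rips V G t) m n \<beta> x)"
    by (simp add: rips_def pull_tuple_compose)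
qed

lemma rips_mono: "s \<le> t \<Longrightarrow> simplices (rips V G s) n \<subseteq> simplices (rips V G t) n"
  unfolding rips_def by (auto intro: order_trans)

lemma pull_rips: "pull (rips V G s) = pull (rips V G t)"
  by (simp add: rips_def)

abbreviation scale :: "'k::field \<Rightarrow> ('x \<Rightarrow>\<^sub>0 'k) \<Rightarrow> ('x \<Rightarrow>\<^sub>0 'k)" where
  "scale a \<equiv> Poly_Mapping.map ((*) a)"

lemma lookup_scale: "Poly_Mapping.lookup (scale a c) x = a * Poly_Mapping.lookup c x"
  by (simp add: Poly_Mapping.map.rep_eq when_def)

lemma keys_scale: "Poly_Mapping.keys (scale a c) \<subseteq> Poly_Mapping.keys c"
  by (auto simp: in_keys_iff lookup_scale)

lemma scale_add: "scale a (c + d) = scale a c + scale a d"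
  by (rule poly_mapping_eqI) (simp add: lookup_scale lookup_add distrib_left)

lemma scale_scale: "scale a (scale b c) = scale (a * b) c"
  by (rule poly_mapping_eqI) (simp add: lookup_scale)

lemma scale_add_left: "scale (a + b) c = scale a c + scale b c"
  by (rule poly_mapping_eqI) (simp add: lookup_scale lookup_add distrib_right)

lemma scale_one: "scale 1 c = c"
  by (rule poly_mapping_eqI) (simp add: lookup_scale)

lemma scale_zero: "scale a 0 = 0"
  by (rule poly_mapping_eqI) (simp add: lookup_scale)

lemma scale_sum: "scale a (sum f S) = (\<Sum>x\<in>S. scale a (f x))"
  by (induction S rule: infinite_finite_induct) (auto simp: scale_add scale_zero)

lemma scale_single: "scale a (Poly_Mapping.single x b) = Poly_Mapping.single x (a * b)"
  by (rule poly_mapping_eqI) (simp add: lookup_scale lookup_single when_def)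

definition lin_ext :: "('x \<Rightarrow> 'y \<Rightarrow>\<^sub>0 'k::field) \<Rightarrow> ('x \<Rightarrow>\<^sub>0 'k) \<Rightarrow> ('y \<Rightarrow>\<^sub>0 'k)" where
  "lin_ext h c = (\<Sum>\<sigma>\<in>Poly_Mapping.keys c. scale (Poly_Mapping.lookup c \<sigma>) (h \<sigma>))"

lemma scale_0_left: "scale 0 c = 0"
  by (rule poly_mapping_eqI) (simp add: lookup_scale)

lemma lin_ext_superset:
  assumes "finite S" "Poly_Mapping.keys c \<subseteq> S"
  shows "lin_ext h c = (\<Sum>\<sigma>\<in>S. scale (Poly_Mapping.lookup c \<sigma>) (h \<sigma>))"
  unfolding lin_ext_def using assms
  by (intro sum.mono_neutral_left) (auto simp: in_keys_iff scale_0_left)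

lemma lin_ext_add: "lin_ext h (c + d) = lin_ext h c + lin_ext h d"
proof -
  let ?S = "Poly_Mapping.keys c \<union> Poly_Mapping.keys d"
  have "Poly_Mapping.keys (c + d) \<subseteq> ?S" by (rule Poly_Mapping.keys_add)
  then show ?thesis
    by (simp add: lin_ext_superset[of ?S] lookup_add scale_add_left sum.distrib)
qed

lemma lin_ext_scale: "lin_ext h (scale a c) = scale a (lin_ext h c)"
  using keys_scale[of a c]
  by (simp add: lin_ext_superset[of "Poly_Mapping.keys c"] lookup_scale scale_sum scale_scale)

lemma lin_ext_zero: "lin_ext h 0 = 0" by (simp add: lin_ext_def)

lemma lin_ext_sum: "lin_ext h (sum f S) = (\<Sum>x\<in>S. lin_ext h (f x))"
  by (induction S rule: infinite_finite_induct) (auto simp: lin_ext_add lin_ext_zero)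

lemma lin_ext_single: "lin_ext h (Poly_Mapping.single x a) = scale a (h x)"
  by (cases "a = 0") (auto simp: lin_ext_def scale_0_left)

lemma lin_ext_ext: "lin_ext g (lin_ext h c) = lin_ext (\<lambda>x. lin_ext g (h x)) c"
  by (simp add: lin_ext_def[of h] lin_ext_def[of "\<lambda>x. lin_ext g (h x)"] lin_ext_sum lin_ext_scale)

lemma lin_ext_cong: "(\<And>x. x \<in> Poly_Mapping.keys c \<Longrightarrow> h x = h' x) \<Longrightarrow> lin_ext h c = lin_ext h' c"
  unfolding lin_ext_def by auto

lemma keys_lin_ext: "Poly_Mapping.keys (lin_ext h c) \<subseteq> (\<Union>x\<in>Poly_Mapping.keys c. Poly_Mapping.keys (h x))"
  unfolding lin_ext_def
  by (rule order_trans[OF Poly_Mapping.keys_sum]) (use keys_scale in fastforce)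

lemma lin_ext_const_0: "lin_ext (\<lambda>x. 0) c = 0"
  by (simp add: lin_ext_def scale_zero)

definition bd_simplex :: "'x sset \<Rightarrow> nat \<Rightarrow> 'x \<Rightarrow> ('x \<Rightarrow>\<^sub>0 'k::field)" where
  "bd_simplex X n \<sigma> = (if n = 0 then 0 else \<Sum>i\<le>n. Poly_Mapping.single (pull X (n - 1) n (coface i) \<sigma>) ((-1) ^ i))"

lemma boundary_eq: "boundary X n c = lin_ext (bd_simplex X n) c"
  by (auto simp: boundary_def lin_ext_def bd_simplex_def scale_sum scale_single scale_zero mult.commute)

lemma chain_map_eq: "chain_map f c = lin_ext (\<lambda>\<sigma>. Poly_Mapping.single (f \<sigma>) 1) c"
  by (simp add: chain_map_def lin_ext_def scale_single)

lemma chain_map_id: "chain_map (\<lambda>y. y) c = c"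
  by (rule poly_mapping_eqI) (simp add: chain_map_def lookup_sum lookup_single when_def in_keys_iff)

context simplicial_set begin

lemma face_face:
  assumes "x \<in> simplices X (Suc (Suc n))" "j < i"
  shows "pull X n (Suc n) (coface j) (pull X (Suc n) (Suc (Suc n)) (coface i) x)
       = pull X n (Suc n) (coface (i - 1)) (pull X (Suc n) (Suc (Suc n)) (coface j) x)"
proof -
  have "(\<lambda>k. coface i (coface j k)) = (\<lambda>k. coface j (coface (i - 1) k))"
    using assms(2) by (cases i) (auto simp: coface_def fun_eq_iff)
  then show ?thesis
    using pull_comp[OF order_preserving_coface order_preserving_coface assms(1), of i j]
      pull_comp[OF order_preserving_coface order_preserving_coface assms(1), of j "i - 1"] by simp
qed

lemma bd_bd: 
  assumes x: "x \<in> simplices X (Suc (Suc n))"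
  shows "lin_ext (bd_simplex X (Suc n)) (bd_simplex X (Suc (Suc n)) x) = (0 :: 'x \<Rightarrow>\<^sub>0 'k::field)"
proof -
  define f :: "nat \<Rightarrow> nat \<Rightarrow> 'x \<Rightarrow>\<^sub>0 'k" where "f = (\<lambda>i j. Poly_Mapping.single
      (pull X n (Suc n) (coface j) (pull X (Suc n) (Suc (Suc n)) (coface i) x)) ((-1) ^ (i + j)))"
  let ?A = "{..Suc (Suc n)} \<times> {..Suc n}"
  let ?lo = "{(i,j) \<in> ?A. j < i}" and ?hi = "{(i,j) \<in> ?A. i \<le> j}"
  have "lin_ext (bd_simplex X (Suc n)) (bd_simplex X (Suc (Suc n)) x) = (\<Sum>i\<le>Suc (Suc n). \<Sum>j\<le>Suc n. f i j)"
    by (simp add: bd_simplex_def lin_ext_sum lin_ext_single scale_sum scale_single f_def power_add scale_add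
        del: sum.atMost_Suc)
  also have "\<dots> = (\<Sum>(i,j)\<in>?A. f i j)" by (rule sum.cartesian_product)
  also have "\<dots> = (\<Sum>(i,j)\<in>?lo. f i j) + (\<Sum>(i,j)\<in>?hi. f i j)"
  proof -
    have "?A = ?lo \<union> ?hi" "?lo \<inter> ?hi = {}" "finite ?lo" "finite ?hi"
      by (auto intro: finite_subset[of _ ?A])
    then show ?thesis by (metis (no_types, lifting) sum.union_disjoint)
  qed
  also have "(\<Sum>(i,j)\<in>?lo. f i j) = (\<Sum>(i,j)\<in>?hi. - f i j)"
  proof (rule sum.reindex_bij_witness[where i = "\<lambda>(i,j). (Suc j, i)" and j = "\<lambda>(i,j). (j, i - 1)"])
    fix a assume "a \<in> ?lo"
    then obtain i j where a: "a = (i,j)" "j < i" "i \<le> Suc (Suc n)" by auto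
    then have "f i j = - f j (i - 1)"
      using face_face[OF x a(2)] by (cases i) (auto simp: f_def single_uminus[symmetric] algebra_simps)
    then show "(case case a of (i, j) \<Rightarrow> (j, i - 1) of (i, j) \<Rightarrow> - f i j) = (case a of (i, j) \<Rightarrow> f i j)"
      using a by simp
  qed auto
  finally show ?thesis by (simp add: sum_negf split_def)
qed

lemma keys_bd:
  assumes "x \<in> simplices X (Suc n)"
  shows "Poly_Mapping.keys (bd_simplex X (Suc n) x :: 'x \<Rightarrow>\<^sub>0 'k::field) \<subseteq> simplices X n"
proof -
  have "Poly_Mapping.keys (bd_simplex X (Suc n) x :: 'x \<Rightarrow>\<^sub>0 'k) \<subseteq>
     (\<Union>i\<le>Suc n. Poly_Mapping.keys (Poly_Mapping.single (pull X n (Suc n) (coface i) x) ((-1) ^ i :: 'k)))"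
    unfolding bd_simplex_def using Poly_Mapping.keys_sum[of "\<lambda>i. Poly_Mapping.single (pull X n (Suc n) (coface i) x) ((-1) ^ i :: 'k)" "{..Suc n}"]
    by (simp del: sum.atMost_Suc Poly_Mapping.keys_single)
  then show ?thesis
    using pull_closed[OF order_preserving_coface assms] by fastforce
qed

lemma boundaries_sub_cycles: "boundaries X n \<subseteq> (cycles X n :: ('x \<Rightarrow>\<^sub>0 'k::field) set)"
proof (clarsimp simp: boundaries_def cycles_def chains_def boundary_eq lin_ext_ext, intro conjI subsetI)
  fix c :: "'x \<Rightarrow>\<^sub>0 'k" assume c: "Poly_Mapping.keys c \<subseteq> simplices X (Suc n)"
  show "x \<in> simplices X n" if "x \<in> Poly_Mapping.keys (lin_ext (bd_simplex X (Suc n)) c)" for x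
    using that keys_lin_ext[of "bd_simplex X (Suc n)" c] c keys_bd by blast
  show "lin_ext (\<lambda>x. lin_ext (bd_simplex X n) (bd_simplex X (Suc n) x)) c = 0"
  proof (cases n)
    case 0
    then have "bd_simplex X n = (\<lambda>_. 0 :: 'x \<Rightarrow>\<^sub>0 'k)" by (auto simp: bd_simplex_def)
    then show ?thesis by (simp add: lin_ext_const_0)
  next
    case (Suc m)
    have "lin_ext (\<lambda>x. lin_ext (bd_simplex X n) (bd_simplex X (Suc n) x)) c = lin_ext (\<lambda>x. 0) c"
      by (rule lin_ext_cong) (use c Suc bd_bd in auto)
    then show ?thesis by (simp add: lin_ext_const_0)
  qed
qed

end

definition bcoset :: "('x \<Rightarrow>\<^sub>0 'k::field) set \<Rightarrow> ('x \<Rightarrow>\<^sub>0 'k) \<Rightarrow> ('x \<Rightarrow>\<^sub>0 'k) set" where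
  "bcoset B z = (\<lambda>b. b + z) ` B"

definition subspace_set :: "('x \<Rightarrow>\<^sub>0 'k::field) set \<Rightarrow> bool" where
  "subspace_set B \<longleftrightarrow> 0 \<in> B \<and> (\<forall>x\<in>B. \<forall>y\<in>B. x + y \<in> B) \<and> (\<forall>a. \<forall>x\<in>B. scale a x \<in> B)"

lemma scale_m1: "scale (-1) c = - c"
  by (rule poly_mapping_eqI) (simp add: lookup_scale)

lemma subspace_set_diff: "subspace_set B \<Longrightarrow> x \<in> B \<Longrightarrow> y \<in> B \<Longrightarrow> x - y \<in> B"
  unfolding subspace_set_def by (metis scale_m1 add_uminus_conv_diff)

lemma in_bcoset: "z \<in> bcoset B w \<longleftrightarrow> z - w \<in> B"
  unfolding bcoset_def by force

lemma subspace_set_add: "subspace_set B \<Longrightarrow> x \<in> B \<Longrightarrow> y \<in> B \<Longrightarrow> x + y \<in> B" by (simp add: subspace_set_def)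
lemma subspace_set_scale: "subspace_set B \<Longrightarrow> x \<in> B \<Longrightarrow> scale a x \<in> B" by (simp add: subspace_set_def)
lemma subspace_set_0: "subspace_set B \<Longrightarrow> 0 \<in> B" by (simp add: subspace_set_def)

lemma bcoset_eq: "subspace_set B \<Longrightarrow> bcoset B z = bcoset B w \<longleftrightarrow> z - w \<in> B"
proof
  assume "subspace_set B" "bcoset B z = bcoset B w"
  then show "z - w \<in> B" using in_bcoset[of z B w] in_bcoset[of z B z] subspace_set_0 by auto
next
  assume B: "subspace_set B" "z - w \<in> B"
  have "x - z \<in> B \<longleftrightarrow> x - w \<in> B" for x
    using subspace_set_add[OF B(1) _ B(2), of "x - z"] subspace_set_diff[OF B(1) _ B(2), of "x - w"] by auto
  then show "bcoset B z = bcoset B w" unfolding set_eq_iff in_bcoset by blast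
qed

lemma bcoset_self: "subspace_set B \<Longrightarrow> z \<in> bcoset B z" by (simp add: in_bcoset subspace_set_0)

lemma coset_chains: "B +>\<^bsub>chains X n\<lparr>carrier := Z\<rparr>\<^esub> z = bcoset B z" "B +>\<^bsub>chains X n\<^esub> z = bcoset B z"
  by (auto simp: a_r_coset_def r_coset_def bcoset_def chains_def)

lemma UN_bcoset: 
  assumes "subspace_set B" "subspace_set B'" "\<And>z w. z - w \<in> B \<Longrightarrow> f z - f w \<in> B'"
  shows "(\<Union>x\<in>bcoset B z. bcoset B' (f x)) = bcoset B' (f z)"
proof -
  have "bcoset B' (f x) = bcoset B' (f z)" if "x \<in> bcoset B z" for x
    using assms(3)[of x z] that unfolding in_bcoset bcoset_eq[OF assms(2)] by blast
  then show ?thesis using bcoset_self[OF assms(1)] by blast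
qed

lemma bcoset_add: "subspace_set B \<Longrightarrow> bcoset B x <+>\<^bsub>chains X n\<lparr>carrier := Z\<rparr>\<^esub> bcoset B y = bcoset B (x + y)"
proof -
  assume B: "subspace_set B"
  have "(\<exists>xa\<in>bcoset B x. \<exists>xb\<in>bcoset B y. z = xa + xb) \<longleftrightarrow> z \<in> bcoset B (x + y)" for z
  proof
    assume "z \<in> bcoset B (x + y)"
    then have "z - y \<in> bcoset B x" by (simp add: in_bcoset algebra_simps)
    then show "\<exists>xa\<in>bcoset B x. \<exists>xb\<in>bcoset B y. z = xa + xb"
      using bcoset_self[OF B, of y] by (metis diff_add_cancel)
  next
    assume "\<exists>xa\<in>bcoset B x. \<exists>xb\<in>bcoset B y. z = xa + xb"
    then obtain a b where ab: "a - x \<in> B" "b - y \<in> B" "z = a + b" by (auto simp: in_bcoset)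
    have "z - (x + y) = (a - x) + (b - y)" by (simp add: ab(3) algebra_simps)
    then show "z \<in> bcoset B (x + y)" using subspace_set_add[OF B ab(1,2)] by (simp only: in_bcoset)
  qed
  then show ?thesis by (auto simp: set_add_def set_mult_def chains_def)
qed

lemma scale_diff: "scale a (c - d) = scale a c - scale a d"
  by (rule poly_mapping_eqI) (simp add: lookup_scale lookup_minus right_diff_distrib)

lemma bcoset_scale: "subspace_set B \<Longrightarrow> (\<Union>x\<in>bcoset B z. bcoset B (scale a x)) = bcoset B (scale a z)"
  by (rule UN_bcoset) (auto simp: scale_diff[symmetric] subspace_set_scale)

lemma quot_simps:
  assumes "subspace_set B"
  shows "carrier (quotient_module (chains X n\<lparr>carrier := Z\<rparr>) B) = bcoset B ` Z"
    "zero (quotient_module (chains X n\<lparr>carrier := Z\<rparr>) B) = bcoset B 0"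
    "add (quotient_module (chains X n\<lparr>carrier := Z\<rparr>) B) (bcoset B x) (bcoset B y) = bcoset B (x + y)"
    "module.smult (quotient_module (chains X n\<lparr>carrier := Z\<rparr>) B) a (bcoset B x) = bcoset B (scale a x)"
proof -
  show "carrier (quotient_module (chains X n\<lparr>carrier := Z\<rparr>) B) = bcoset B ` Z"
    using coset_chains(1)[unfolded a_r_coset_def, where X = X and n = n and B = B and Z = Z]
    by (auto simp add: quotient_module_def A_RCOSETS_def RCOSETS_def simp del: partial_object.update_convs)
  show "zero (quotient_module (chains X n\<lparr>carrier := Z\<rparr>) B) = bcoset B 0"
    by (auto simp: quotient_module_def in_bcoset)
  show "add (quotient_module (chains X n\<lparr>carrier := Z\<rparr>) B) (bcoset B x) (bcoset B y) = bcoset B (x + y)"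
    using bcoset_add[OF assms] by (simp add: quotient_module_def)
  show "module.smult (quotient_module (chains X n\<lparr>carrier := Z\<rparr>) B) a (bcoset B x) = bcoset B (scale a x)"
    using bcoset_scale[OF assms] by (simp add: quotient_module_def coset_chains) (simp add: chains_def)
qed

lemma quot_vs:
  fixes B :: "('x \<Rightarrow>\<^sub>0 'k::field) set"
  assumes B: "subspace_set B" and Z: "subspace_set Z" and BZ: "B \<subseteq> Z"
  shows "vectorspace class_ring (quotient_module (chains X n\<lparr>carrier := Z\<rparr>) B)"
    (is "vectorspace _ ?Q")
proof -
  note q = quot_simps[OF B, where X = X and n = n and Z = Z]
  have ag: "abelian_group ?Q"
  proof (rule abelian_groupI)
    fix x assume "x \<in> carrier ?Q"
    then obtain z where z: "z \<in> Z" "x = bcoset B z" by (auto simp: q)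
    then have "- z \<in> Z" using subspace_set_scale[OF Z z(1), of "-1"] by (simp add: scale_m1)
    then show "\<exists>y\<in>carrier ?Q. y \<oplus>\<^bsub>?Q\<^esub> x = \<zero>\<^bsub>?Q\<^esub>"
      by (intro bexI[of _ "bcoset B (-z)"]) (auto simp: q z)
  qed (auto simp: q subspace_set_0[OF Z] subspace_set_add[OF Z] add.assoc add.commute add.left_commute)
  have "module class_ring ?Q"
  proof (rule moduleI[OF _ ag])
    show "cring (class_ring :: 'k ring)" by (rule class_cring.cring_axioms)
  qed (auto simp: q subspace_set_scale[OF Z] scale_add scale_add_left scale_scale scale_one)
  then show ?thesis 
    by (intro vectorspace.intro class_field.field_axioms)
qed

lemma subspace_set_boundaries: "subspace_set (boundaries X n :: ('x \<Rightarrow>\<^sub>0 'k::field) set)"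
  unfolding subspace_set_def
proof (intro conjI ballI allI)
  show "0 \<in> (boundaries X n :: ('x \<Rightarrow>\<^sub>0 'k::field) set)"
    by (auto simp: boundaries_def boundary_eq chains_def intro!: image_eqI[of _ _ 0] simp: lin_ext_zero)
next
  fix b c :: "'x \<Rightarrow>\<^sub>0 'k" assume "b \<in> boundaries X n" "c \<in> boundaries X n"
  then obtain b' c' where "b' \<in> carrier (chains X (Suc n))" "c' \<in> carrier (chains X (Suc n))" 
    "b = boundary X (Suc n) b'" "c = boundary X (Suc n) c'" by (auto simp: boundaries_def)
  then show "b + c \<in> boundaries X n"
    unfolding boundaries_def using Poly_Mapping.keys_add[of b' c']
    by (intro image_eqI[of _ _ "b' + c'"]) (auto simp: boundary_eq lin_ext_add chains_def)
next
  fix b :: "'x \<Rightarrow>\<^sub>0 'k" and a assume "b \<in> boundaries X n"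
  then obtain b' where "b' \<in> carrier (chains X (Suc n))"
    "b = boundary X (Suc n) b'" by (auto simp: boundaries_def)
  then show "scale a b \<in> boundaries X n"
    unfolding boundaries_def using keys_scale[of a b']
    by (intro image_eqI[of _ _ "scale a b'"]) (auto simp: boundary_eq lin_ext_scale chains_def)
qed

lemma subspace_set_cycles: "subspace_set (cycles X n :: ('x \<Rightarrow>\<^sub>0 'k::field) set)"
  unfolding subspace_set_def cycles_def
proof (intro conjI ballI allI)
  fix b c :: "'x \<Rightarrow>\<^sub>0 'k" assume "b \<in> {c \<in> carrier (chains X n). boundary X n c = 0}" "c \<in> {c \<in> carrier (chains X n). boundary X n c = 0}"
  then show "b + c \<in> {c \<in> carrier (chains X n). boundary X n c = 0}" 
    using Poly_Mapping.keys_add[of b c] by (auto simp: boundary_eq lin_ext_add chains_def)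
next
  fix b :: "'x \<Rightarrow>\<^sub>0 'k" and a assume "b \<in> {c \<in> carrier (chains X n). boundary X n c = 0}"
  then show "scale a b \<in> {c \<in> carrier (chains X n). boundary X n c = 0}" 
    using keys_scale[of a b] by (auto simp: boundary_eq lin_ext_scale scale_zero chains_def)
qed (auto simp: boundary_eq lin_ext_zero chains_def)

lemma (in simplicial_set) vectorspace_homology:
  "vectorspace class_ring (homology X n :: ('k::field, ('x \<Rightarrow>\<^sub>0 'k) set) module)"
  unfolding homology_def
  by (rule quot_vs[OF subspace_set_boundaries subspace_set_cycles boundaries_sub_cycles])

lemma boundary_rips: "boundary (rips V G s) n = boundary (rips V G t) n"
  by (simp add: fun_eq_iff boundary_def rips_def)

lemma rips_cycles_mono: "s \<le> t \<Longrightarrow> cycles (rips V G s) n \<subseteq> cycles (rips V G t) n"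
  unfolding cycles_def using rips_mono[of s t V G n] unfolding boundary_rips[of V G s n t]
  by (auto simp: chains_def)

lemma rips_boundaries_mono: "s \<le> t \<Longrightarrow> boundaries (rips V G s) n \<subseteq> boundaries (rips V G t) n"
  unfolding boundaries_def using rips_mono[of s t V G "Suc n"] unfolding boundary_rips[of V G s "Suc n" t]
  by (auto simp: chains_def)

lemma homology_map_rips:
  "s \<le> t \<Longrightarrow> homology_map (rips V G t) n (\<lambda>y. y) (bcoset (boundaries (rips V G s) n) z)
     = bcoset (boundaries (rips V G t) n) z"
  unfolding homology_map_def chain_map_id coset_chains
  by (rule UN_bcoset) (use subspace_set_boundaries rips_boundaries_mono in blast)+

lemma vectorspace_rips_homology: "vectorspace class_ring (pspace (rips_homology K n V G) r)"
  by (simp add: rips_homology_def simplicial_set.vectorspace_homology[OF simplicial_set_rips])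

lemma linear_map_rips_homology:
  assumes st: "s \<le> t"
  shows "linear_map class_ring (pspace (rips_homology K n V G) s) (pspace (rips_homology K n V G) t)
    (pmap (rips_homology K n V G) s t)"
proof -
  have "pmap (rips_homology K n V G) s t \<in> LinearCombinations.module_hom class_ring
      (pspace (rips_homology K n V G) s) (pspace (rips_homology K n V G) t)"
    using rips_cycles_mono[OF st, of V G n]
    by (auto simp: module_hom_def rips_homology_def homology_def quot_simps[OF subspace_set_boundaries]
        homology_map_rips[OF st])
  then show ?thesis
    using vectorspace_rips_homology[of K n V G]
    by (intro linear_map.intro mod_hom.intro mod_hom_axioms.intro vectorspace.axioms(1))
qed

theorem persistence_module_rips_homology: "persistence_module (rips_homology K n V G)"
proof (rule persistence_module.intro[OF linear_map_rips_homology])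
  fix t x assume "x \<in> carrier (pspace (rips_homology K n V G) t)"
  then show "pmap (rips_homology K n V G) t t x = x"
    by (auto simp: rips_homology_def homology_def quot_simps[OF subspace_set_boundaries]
        homology_map_rips[OF order_refl])
next
  fix r s t :: L and x assume "r \<le> s" "s \<le> t" "x \<in> carrier (pspace (rips_homology K n V G) r)"
  then show "pmap (rips_homology K n V G) s t (pmap (rips_homology K n V G) r s x) =
      pmap (rips_homology K n V G) r t x"
    by (auto simp: rips_homology_def homology_def quot_simps[OF subspace_set_boundaries]
        homology_map_rips[OF \<open>r \<le> s\<close>] homology_map_rips[OF \<open>s \<le> t\<close>]
        homology_map_rips[OF order_trans[OF \<open>r \<le> s\<close> \<open>s \<le> t\<close>]])
qed

end

theory Submission
  imports Defs
begin

text \<open>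
  The formula for the network distance is a computation in \<open>[0, \<infinity>]\<close>. The least \<open>c\<close> with
  \<open>b \<le> a + c\<close> is the truncated difference \<open>b - a\<close>, except that it is \<open>0\<close> when \<open>a = \<infinity>\<close>; taking both
  directions together gives \<open>\<bar>a - b\<bar>\<close> with \<open>\<bar>\<infinity> - \<infinity>\<bar> = 0\<close> (\<open>sup_excess\<close>). Infima, suprema and sums
  in \<open>L\<close> are coordinatewise, so the two coordinates separate (\<open>sup_coords_delta_plus\<close>).

  The interleaving bound is the usual contiguity argument. As \<open>d\<close> is symmetric, a
  simplex of \<open>R\<^sup>t\<close> is a tuple all of whose pairs of entries have \<open>G\<close>-value at most \<open>t\<close>
  (\<open>simplices_rips_function_graph\<close>), a condition that depends on the set of entries only.
  Let \<open>C\<close> be a correspondence of cost \<open>\<epsilon>\<close>. Maps \<open>f : V\<^sub>1 \<rightarrow> V\<^sub>2\<close> and \<open>g : V\<^sub>2 \<rightarrow> V\<^sub>1\<close> with graphs in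
  \<open>C\<close> raise \<open>G\<close>-values by at most \<open>\<epsilon>\<close>, hence induce maps of persistence modules of degree
  \<open>(\<epsilon>, \<epsilon>)\<close>. A point \<open>v\<close> and its image \<open>g (f v)\<close> correspond to the same point \<open>f v\<close>, so every tuple
  made of entries of a simplex of \<open>R\<^sup>t\<close> and of their images under \<open>g \<circ> f\<close> is a simplex two steps of
  \<open>(\<epsilon>, \<epsilon>)\<close> later. This makes \<open>g \<circ> f\<close> and the inclusion contiguous.

  Contiguous vertex maps agree in homology by an acyclic carrier argument
  (\<open>boundary_carrier_homotopy\<close>): the tuples with entries in a fixed set are contracted by the cone
  \<open>\<tau> \<mapsto> (v, \<tau>)\<close>, and coning off the cycle that remains to be filled defines a chain homotopy by
  recursion on the dimension.
\<close>

section \<open>The network distance\<close>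

lemma le_add_excess: "(b::ennreal) \<le> a + (b - a)"
proof (cases "a \<le> b")
  case False
  then have "b \<le> a" by simp
  also have "a \<le> a + (b - a)" by simp
  finally show ?thesis .
qed (simp add: add_diff_inverse_ennreal)

text \<open>The case \<open>a = \<infinity>\<close> is separate because \<open>\<infinity> - \<infinity> = \<infinity>\<close> in \<^typ>\<open>ennreal\<close>.\<close>

lemma Inf_excess: "Inf {c::ennreal. b \<le> a + c} = (if a = \<infinity> then 0 else b - a)"
proof (cases "a = \<infinity>")
  case False
  show ?thesis
  proof (rule antisym)
    have "b \<le> a + (b - a)"
      by (rule le_add_excess)
    then show "Inf {c. b \<le> a + c} \<le> (if a = \<infinity> then 0 else b - a)"
      using False by (auto intro: Inf_lower)
    show "(if a = \<infinity> then 0 else b - a) \<le> Inf {c. b \<le> a + c}"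
      by (rule Inf_greatest) (use False in \<open>auto simp: ennreal_minus_le_iff\<close>)
  qed
next
  case True
  then have "Inf {c. b \<le> a + c} \<le> 0" by (intro Inf_lower) simp
  then show ?thesis using True by simp
qed

lemma sup_excess: "sup (Inf {c::ennreal. b \<le> a + c}) (Inf {c. a \<le> b + c}) = absdiff a b"
proof -
  have zero: "x - y = 0" if "x \<le> y" "x \<noteq> \<infinity>" for x y :: ennreal
    using that by (simp add: diff_eq_0_ennreal less_top)
  show ?thesis
    unfolding Inf_excess absdiff_def
    by (cases "a \<le> b") (auto simp: zero sup_max max_def top_unique)
qed

lemma Inf_excess_prod:
  "Inf {c::L. q \<le> p + c} = (Inf {c. fst q \<le> fst p + c}, Inf {c. snd q \<le> snd p + c})"
proof -
  have S: "{c::L. q \<le> p + c} = {c. fst q \<le> fst p + c} \<times> {c. snd q \<le> snd p + c}"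
    by (auto simp: less_eq_prod_def)
  have "\<infinity> \<in> {c::ennreal. fst q \<le> fst p + c}" "\<infinity> \<in> {c::ennreal. snd q \<le> snd p + c}" by auto
  then show ?thesis unfolding S Inf_prod_def by (metis empty_iff fst_image_times snd_image_times)
qed

lemma delta_plus_eq:
  "delta_plus C (pullback fst (function_graph d1 \<gamma>1)) (pullback snd (function_graph d2 \<gamma>2)) =
    (SUP (p, q)\<in>C \<times> C. (absdiff (d1 (fst p) (fst q)) (d2 (snd p) (snd q)),
                         absdiff (\<gamma>1 (fst p)) (\<gamma>2 (snd p))))"
  unfolding delta_plus_def dir_delta_plus_def split_def complete_lattice_class.SUP_sup_distrib
  by (rule SUP_cong)
     (auto simp: Inf_excess_prod pullback_def function_graph_def sup_excess sup_prod_def)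

lemma sup_coords_delta_plus:
  "sup_coords (delta_plus C (pullback fst (function_graph d1 \<gamma>1))
                            (pullback snd (function_graph d2 \<gamma>2))) =
    max (SUP ((v1, v2), (v1', v2')) \<in> C \<times> C. absdiff (d1 v1 v1') (d2 v2 v2'))
        (SUP (v1, v2) \<in> C. absdiff (\<gamma>1 v1) (\<gamma>2 v2))"
proof -
  have "(SUP ((v1, v2), q) \<in> C \<times> C. absdiff (\<gamma>1 v1) (\<gamma>2 v2)) =
      (SUP (v1, v2) \<in> C. absdiff (\<gamma>1 v1) (\<gamma>2 v2))"
  proof (rule antisym)
    show "(SUP ((v1, v2), q) \<in> C \<times> C. absdiff (\<gamma>1 v1) (\<gamma>2 v2))
        \<le> (SUP (v1, v2) \<in> C. absdiff (\<gamma>1 v1) (\<gamma>2 v2))"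
      by (rule SUP_least) (auto intro: SUP_upper2)
    show "(SUP (v1, v2) \<in> C. absdiff (\<gamma>1 v1) (\<gamma>2 v2))
        \<le> (SUP ((v1, v2), q) \<in> C \<times> C. absdiff (\<gamma>1 v1) (\<gamma>2 v2))"
    proof (rule SUP_least)
      fix p assume "p \<in> C"
      then show "(case p of (v1, v2) \<Rightarrow> absdiff (\<gamma>1 v1) (\<gamma>2 v2))
          \<le> (SUP ((v1, v2), q) \<in> C \<times> C. absdiff (\<gamma>1 v1) (\<gamma>2 v2))"
        by (intro SUP_upper2[of "(p, p)"]) (auto split: prod.split)
    qed
  qed
  then show ?thesis
    by (simp add: sup_coords_def delta_plus_eq sup_max fst_SUP snd_SUP split_def image_image)
qed

lemma le_add_absdiff: "a \<le> b + absdiff a b" "b \<le> a + absdiff a b"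
proof -
  have "a \<le> b + absdiff a b \<and> b \<le> a + absdiff a b"
  proof (cases "a \<le> b")
    case True
    then show ?thesis by (auto simp: absdiff_def le_add_excess add_increasing2)
  next
    case False
    then show ?thesis by (auto simp: absdiff_def le_add_excess add_increasing2)
  qed
  then show "a \<le> b + absdiff a b" "b \<le> a + absdiff a b" by auto
qed

lemma correspondence_distortion:
  fixes d1 \<gamma>1 d2 \<gamma>2 C
  defines "G1 \<equiv> function_graph d1 \<gamma>1" and "G2 \<equiv> function_graph d2 \<gamma>2"
  defines "\<epsilon> \<equiv> sup_coords (delta_plus C (pullback fst G1) (pullback snd G2))"
  assumes "(v, w) \<in> C" "(v', w') \<in> C"
  shows "G2 w w' \<le> G1 v v' + (\<epsilon>, \<epsilon>)" "G1 v v' \<le> G2 w w' + (\<epsilon>, \<epsilon>)"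
proof -
  have e1: "absdiff (d1 v v') (d2 w w') \<le> \<epsilon>"
    unfolding \<epsilon>_def G1_def G2_def sup_coords_delta_plus using assms(4,5)
    by (intro max.coboundedI1 SUP_upper2[of "((v, w), (v', w'))"]) auto
  have e2: "absdiff (\<gamma>1 v) (\<gamma>2 w) \<le> \<epsilon>"
    unfolding \<epsilon>_def G1_def G2_def sup_coords_delta_plus using assms(4)
    by (intro max.coboundedI2 SUP_upper2[of "(v, w)"]) auto
  show "G2 w w' \<le> G1 v v' + (\<epsilon>, \<epsilon>)" "G1 v v' \<le> G2 w w' + (\<epsilon>, \<epsilon>)"
    unfolding G1_def G2_def function_graph_def
    using order_trans[OF le_add_absdiff(1) add_left_mono[OF e1]]
      order_trans[OF le_add_absdiff(2) add_left_mono[OF e1]]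
      order_trans[OF le_add_absdiff(1) add_left_mono[OF e2]]
      order_trans[OF le_add_absdiff(2) add_left_mono[OF e2]]
    by simp_all
qed

section \<open>Simplices of the Rips construction\<close>

lemma path_sup_le:
  assumes "y \<noteq> []" "\<And>u v. u \<in> set y \<Longrightarrow> v \<in> set y \<Longrightarrow> G u v \<le> t"
  shows "path_sup G y \<le> t"
proof (cases "\<forall>i<length y. y ! i = y ! 0")
  case True
  then have "path_sup G y = G (y ! 0) (y ! 0)" unfolding path_sup_def by (rule if_P)
  then show ?thesis using assms(2)[of "y ! 0" "y ! 0"] assms(1) by simp
next
  case False
  then have "path_sup G y =
      (SUP i \<in> {i. 1 \<le> i \<and> i < length y \<and> y ! (i - 1) \<noteq> y ! i}. G (y ! (i - 1)) (y ! i))"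
    unfolding path_sup_def by (rule if_not_P)
  also have "\<dots> \<le> t"
    by (rule SUP_least) (auto intro!: assms(2) nth_mem)
  finally show ?thesis .
qed

lemma path_sup_singleton: "path_sup G [v] = G v v"
  by (simp add: path_sup_def)

lemma path_sup_pair: "u \<noteq> v \<Longrightarrow> path_sup G [u, v] = G u v"
proof -
  assume "u \<noteq> v"
  then have "\<not> (\<forall>i<length [u, v]. [u, v] ! i = [u, v] ! 0)"
    by (auto dest: spec[of _ 1])
  then have "path_sup G [u, v] = (SUP i \<in> {i. 1 \<le> i \<and> i < length [u, v] \<and>
      [u, v] ! (i - 1) \<noteq> [u, v] ! i}. G ([u, v] ! (i - 1)) ([u, v] ! i))"
    unfolding path_sup_def by (rule if_not_P)
  moreover have "{i. 1 \<le> i \<and> i < length [u, v] \<and> [u, v] ! (i - 1) \<noteq> [u, v] ! i} = {1}"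
    using \<open>u \<noteq> v\<close> by (auto simp: less_Suc_eq)
  ultimately show ?thesis by (simp only: image_insert image_empty Sup_insert Sup_empty) simp
qed

lemma set_pull_tuple:
  "order_preserving m n \<alpha> \<Longrightarrow> length y = Suc n \<Longrightarrow> set (pull_tuple m \<alpha> y) \<subseteq> set y"
  by (auto simp: pull_tuple_def less_Suc_eq_le order_preserving_le simp del: upt_Suc)

text \<open>
  The edges of a simplex only bound \<open>G (y ! i) (y ! j)\<close> for \<open>i < j\<close>; symmetry of the metric and
  the vertices, which bound \<open>\<gamma>\<close>, take care of \<open>i > j\<close>.
\<close>

lemma simplices_rips_function_graph:
  assumes d: "extended_metric_on V d"
  shows "simplices (rips V (function_graph d \<gamma>) t) n =
    {y. length y = Suc n \<and> set y \<subseteq> V \<and> (\<forall>u\<in>set y. \<forall>v\<in>set y. function_graph d \<gamma> u v \<le> t)}"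
    (is "?L = ?R")
proof
  let ?G = "function_graph d \<gamma>"
  show "?R \<subseteq> ?L"
  proof
    fix y assume y: "y \<in> ?R"
    have "path_sup ?G (pull_tuple m \<alpha> y) \<le> t" if "order_preserving m n \<alpha>" for m \<alpha>
    proof (rule path_sup_le)
      show "pull_tuple m \<alpha> y \<noteq> []" by (simp add: pull_tuple_def)
      show "?G u v \<le> t" if "u \<in> set (pull_tuple m \<alpha> y)" "v \<in> set (pull_tuple m \<alpha> y)" for u v
        using y subsetD[OF set_pull_tuple[OF \<open>order_preserving m n \<alpha>\<close>, of y]] that by blast
    qed
    then show "y \<in> ?L" using y by (auto simp: rips_def)
  qed
  show "?L \<subseteq> ?R"
  proof
    fix y assume "y \<in> ?L"
    then have len: "length y = Suc n" and V: "set y \<subseteq> V"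
      and P: "\<And>m \<alpha>. order_preserving m n \<alpha> \<Longrightarrow> path_sup ?G (pull_tuple m \<alpha> y) \<le> t"
      by (auto simp: rips_def)
    have vertex: "?G (y ! i) (y ! i) \<le> t" if "i \<le> n" for i
      using P[of 0 "\<lambda>_. i"] that
      by (simp add: order_preserving_def mono_on_def pull_tuple_def path_sup_singleton)
    have edge: "?G (y ! i) (y ! j) \<le> t" if "i < j" "j \<le> n" "y ! i \<noteq> y ! j" for i j
    proof -
      have "order_preserving 1 n (\<lambda>k. if k = 0 then i else j)"
        using that by (auto simp: order_preserving_def mono_on_def)
      from P[OF this] show ?thesis using that by (simp add: pull_tuple_def path_sup_pair)
    qed
    have all: "?G (y ! i) (y ! j) \<le> t" if "i \<le> n" "j \<le> n" for i j
    proof (cases "y ! i = y ! j")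
      case False
      have "d (y ! i) (y ! j) = d (y ! j) (y ! i)"
        using d V len that unfolding extended_metric_on_def by (simp add: subset_iff)
      then show ?thesis
        using edge[of i j] edge[of j i] vertex[of i] that False
        by (cases i j rule: linorder_cases) (auto simp: function_graph_def less_eq_prod_def)
    qed (use vertex that in metis)
    show "y \<in> ?R" using len V all by (auto simp: in_set_conv_nth less_Suc_eq_le)
  qed
qed

section \<open>Chains of tuples\<close>

lemma lin_ext_minus_fun: "lin_ext (\<lambda>x. h x - k x) c = lin_ext h c - lin_ext k c"
  by (simp add: lin_ext_def scale_diff sum_subtractf)

lemma lin_ext_diff: "lin_ext h (c - d) = lin_ext h c - lin_ext h d"
  by (metis add_diff_cancel_right' diff_add_cancel lin_ext_add)

lemma chain_map_single: "chain_map f (Poly_Mapping.single x a) = Poly_Mapping.single (f x) a"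
  by (simp add: chain_map_eq lin_ext_single scale_single)

lemma chain_map_add: "chain_map f (c + d) = chain_map f c + chain_map f d"
  by (simp add: chain_map_eq lin_ext_add)

lemma chain_map_diff: "chain_map f (c - d) = chain_map f c - chain_map f d"
  by (simp add: chain_map_eq lin_ext_diff)

lemma chain_map_scale: "chain_map f (scale a c) = scale a (chain_map f c)"
  by (simp add: chain_map_eq lin_ext_scale)

lemma chain_map_sum: "chain_map f (sum g S) = (\<Sum>x\<in>S. chain_map f (g x))"
  by (simp add: chain_map_eq lin_ext_sum)

lemma chain_map_comp: "chain_map f (chain_map g c) = chain_map (f \<circ> g) c"
  by (simp add: chain_map_eq lin_ext_ext lin_ext_single scale_one)

lemma keys_chain_map: "Poly_Mapping.keys (chain_map f c) \<subseteq> f ` Poly_Mapping.keys c"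
  unfolding chain_map_eq using keys_lin_ext[of "\<lambda>\<sigma>. Poly_Mapping.single (f \<sigma>) 1" c] by auto

lemma in_keys_lin_ext: "x \<in> Poly_Mapping.keys (lin_ext h c) \<Longrightarrow>
    \<exists>y\<in>Poly_Mapping.keys c. x \<in> Poly_Mapping.keys (h y)"
  using subsetD[OF keys_lin_ext] by fast

lemma keys_single_diff:
  "Poly_Mapping.keys (Poly_Mapping.single x 1 - Poly_Mapping.single y 1 :: _ \<Rightarrow>\<^sub>0 'k::field) \<subseteq> {x, y}"
  using Poly_Mapping.keys_diff[of "Poly_Mapping.single x 1" "Poly_Mapping.single y (1::'k)"]
  by (simp add: insert_commute)

lemma boundary_diff: "boundary X n (c - d) = boundary X n c - boundary X n d"
  by (simp add: boundary_eq lin_ext_diff)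

lemma boundary_single: "boundary X n (Poly_Mapping.single x 1) = bd_simplex X n x"
  by (simp add: boundary_eq lin_ext_single scale_one)

text \<open>
  The simplicial set of all tuples with entries in an arbitrary type: the Rips construction for
  the constant graph \<open>0\<close>. Its boundary operator is the one of every Rips construction, which
  allows chain homotopies to be built before it is known in which Rips complex they lie.
\<close>

abbreviation tuples :: "'v list sset" where
  "tuples \<equiv> rips UNIV (\<lambda>_ _. 0) 0"

lemma boundary_tuples: "boundary (rips V G t) n = boundary tuples n"
  by (simp add: fun_eq_iff boundary_def rips_def)

lemma simplices_tuples: "simplices tuples n = {y. length y = Suc n}"
proof -
  have "path_sup (\<lambda>_ _. 0) (pull_tuple m \<alpha> y) \<le> 0" for m \<alpha> and y :: "'a list"
    by (rule path_sup_le) (auto simp: pull_tuple_def)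
  then show ?thesis by (auto simp: rips_def)
qed

lemma simplices_rips_sub: "simplices (rips V G t) n \<subseteq> simplices tuples n"
  unfolding simplices_tuples by (auto simp: rips_def)

lemma bd_simplex_tuples_Suc: "bd_simplex tuples (Suc n) y =
    (\<Sum>i\<le>Suc n. Poly_Mapping.single (pull_tuple n (coface i) y) ((-1) ^ i))"
  by (simp add: bd_simplex_def rips_def)

lemma length_pull_tuple: "length (pull_tuple m \<alpha> y) = Suc m"
  by (simp add: pull_tuple_def)

lemma pull_tuple_map:
  "order_preserving m n \<alpha> \<Longrightarrow> length y = Suc n \<Longrightarrow>
    pull_tuple m \<alpha> (map f y) = map f (pull_tuple m \<alpha> y)"
  by (auto simp: pull_tuple_def less_Suc_eq_le order_preserving_le simp del: upt_Suc)

lemma bd_simplex_map: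
  assumes "length y = Suc n"
  shows "bd_simplex tuples n (map f y) = chain_map (map f) (bd_simplex tuples n y)"
proof (cases n)
  case 0
  then show ?thesis by (simp add: bd_simplex_def chain_map_eq lin_ext_zero)
next
  case (Suc m)
  then show ?thesis using assms
    by (simp add: bd_simplex_tuples_Suc chain_map_sum chain_map_single
        pull_tuple_map[OF order_preserving_coface] del: sum.atMost_Suc)
qed

lemma boundary_chain_map:
  assumes "Poly_Mapping.keys c \<subseteq> simplices tuples n"
  shows "boundary tuples n (chain_map (map f) c) = chain_map (map f) (boundary tuples n c)"
proof -
  have "boundary tuples n (chain_map (map f) c) = lin_ext (\<lambda>y. bd_simplex tuples n (map f y)) c"
    by (simp add: boundary_eq chain_map_eq lin_ext_ext lin_ext_single scale_one)
  also have "\<dots> = lin_ext (\<lambda>y. chain_map (map f) (bd_simplex tuples n y)) c"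
    using assms by (intro lin_ext_cong bd_simplex_map) (auto simp: simplices_tuples)
  finally show ?thesis by (simp add: boundary_eq chain_map_eq lin_ext_ext)
qed

section \<open>Acyclic carriers\<close>

lemma pull_tuple_coface_0: "length y = Suc n \<Longrightarrow> pull_tuple n (coface 0) (v # y) = y"
  by (auto simp: pull_tuple_def coface_def intro!: nth_equalityI simp del: upt_Suc)

lemma pull_tuple_coface_Suc:
  "pull_tuple (Suc n) (coface (Suc i)) (v # y) = v # pull_tuple n (coface i) y"
  by (rule nth_equalityI)
     (auto simp: length_pull_tuple pull_tuple_nth less_Suc_eq_le coface_def nth_Cons'
        gr0_conv_Suc)

text \<open>The term in degree \<open>0\<close> is the augmentation: the cone contracts onto its apex.\<close>

lemma boundary_cone:
  assumes "Poly_Mapping.keys c \<subseteq> simplices tuples n"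
  shows "boundary tuples (Suc n) (chain_map ((#) v) c) = c -
    (if n = 0 then chain_map (\<lambda>_. [v]) c else chain_map ((#) v) (boundary tuples n c))"
proof -
  let ?e = "\<lambda>y. if n = 0 then Poly_Mapping.single [v] 1
    else chain_map ((#) v) (bd_simplex tuples n y)"
  have bd: "bd_simplex tuples (Suc n) (v # y) = Poly_Mapping.single y 1 - ?e y"
    if y: "length y = Suc n" for y
  proof (cases n)
    case 0
    then show ?thesis using y pull_tuple_coface_0[of y 0 v]
      by (simp add: bd_simplex_tuples_Suc single_uminus pull_tuple_def[of 0 "coface (Suc 0)"]
        coface_def)
  next
    case (Suc m)
    have "bd_simplex tuples (Suc n) (v # y) = Poly_Mapping.single y 1 +
        (\<Sum>i\<le>n. Poly_Mapping.single (v # pull_tuple m (coface i) y) (- ((-1) ^ i)))"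
      unfolding bd_simplex_tuples_Suc sum.atMost_Suc_shift[of _ n]
      using y Suc by (simp add: pull_tuple_coface_0 pull_tuple_coface_Suc del: sum.atMost_Suc)
    then show ?thesis using Suc
      by (simp add: bd_simplex_tuples_Suc chain_map_sum chain_map_single single_uminus
          sum_negf del: sum.atMost_Suc)
  qed
  have "boundary tuples (Suc n) (chain_map ((#) v) c) =
      lin_ext (\<lambda>y. bd_simplex tuples (Suc n) (v # y)) c"
    by (simp add: boundary_eq chain_map_eq lin_ext_ext lin_ext_single scale_one)
  also have "\<dots> = lin_ext (\<lambda>y. Poly_Mapping.single y 1 - ?e y) c"
    using assms by (intro lin_ext_cong bd) (auto simp: simplices_tuples)
  also have "\<dots> = chain_map (\<lambda>y. y) c - lin_ext ?e c"
    by (simp add: lin_ext_minus_fun chain_map_eq)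
  finally show ?thesis by (simp add: chain_map_id chain_map_eq boundary_eq lin_ext_ext)
qed

text \<open>
  The chain homotopy from the identity to \<open>map h\<close>. Its value on \<open>\<sigma>\<close> must bound
  \<open>h \<sigma> - \<sigma> - D (\<partial> \<sigma>)\<close>, which is a cycle; the cone from the first vertex of \<open>\<sigma>\<close> fills it.
\<close>

primrec carrier_homotopy :: "('v \<Rightarrow> 'v) \<Rightarrow> nat \<Rightarrow> 'v list \<Rightarrow> ('v list \<Rightarrow>\<^sub>0 'k::field)" where
  "carrier_homotopy h 0 \<sigma> = chain_map ((#) (hd \<sigma>))
     (Poly_Mapping.single (map h \<sigma>) 1 - Poly_Mapping.single \<sigma> 1)"
| "carrier_homotopy h (Suc n) \<sigma> = chain_map ((#) (hd \<sigma>))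
     (Poly_Mapping.single (map h \<sigma>) 1 - Poly_Mapping.single \<sigma> 1
       - lin_ext (carrier_homotopy h n) (bd_simplex tuples (Suc n) \<sigma>))"

lemma keys_bd_simplex_tuples:
  assumes "length \<sigma> = Suc (Suc n)"
    and "\<tau> \<in> Poly_Mapping.keys (bd_simplex tuples (Suc n) \<sigma> :: _ \<Rightarrow>\<^sub>0 'k::field)"
  shows "length \<tau> = Suc n \<and> set \<tau> \<subseteq> set \<sigma>"
proof -
  have "\<tau> \<in> (\<Union>i\<le>Suc n. Poly_Mapping.keys
      (Poly_Mapping.single (pull_tuple n (coface i) \<sigma>) ((-1) ^ i :: 'k)))"
    using assms(2) unfolding bd_simplex_tuples_Suc by (rule subsetD[OF Poly_Mapping.keys_sum])
  then obtain i where "\<tau> = pull_tuple n (coface i) \<sigma>" by (auto split: if_splits)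
  then show ?thesis
    using set_pull_tuple[OF order_preserving_coface assms(1)] by (simp add: length_pull_tuple)
qed

lemma keys_carrier_homotopy:
  assumes "length \<sigma> = Suc n"
    and "\<tau> \<in> Poly_Mapping.keys (carrier_homotopy h n \<sigma> :: _ \<Rightarrow>\<^sub>0 'k::field)"
  shows "length \<tau> = Suc (Suc n) \<and> set \<tau> \<subseteq> set \<sigma> \<union> h ` set \<sigma>"
  using assms
proof (induction n arbitrary: \<sigma> \<tau>)
  case 0
  then obtain v where v: "\<sigma> = [v]" by (auto simp: length_Suc_conv)
  have "Poly_Mapping.keys (Poly_Mapping.single [h v] 1 - Poly_Mapping.single [v] 1 :: _ \<Rightarrow>\<^sub>0 'k)
      \<subseteq> {[h v], [v]}"
    by (rule keys_single_diff)
  then have "\<tau> \<in> (#) v ` {[h v], [v]}"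
    using 0(2) subsetD[OF keys_chain_map] unfolding v by (fastforce simp: image_iff)
  then show ?case by (auto simp: v)
next
  case (Suc n)
  let ?p = "Poly_Mapping.single (map h \<sigma>) 1 - Poly_Mapping.single \<sigma> 1 :: _ \<Rightarrow>\<^sub>0 'k"
  let ?q = "lin_ext (carrier_homotopy h n) (bd_simplex tuples (Suc n) \<sigma>) :: _ \<Rightarrow>\<^sub>0 'k"
  have p: "Poly_Mapping.keys ?p \<subseteq> {map h \<sigma>, \<sigma>}" by (rule keys_single_diff)
  have q: "length \<rho> = Suc (Suc n) \<and> set \<rho> \<subseteq> set \<sigma> \<union> h ` set \<sigma>"
    if "\<rho> \<in> Poly_Mapping.keys ?q" for \<rho>
  proof -
    obtain \<omega> where \<omega>: "\<omega> \<in> Poly_Mapping.keys (bd_simplex tuples (Suc n) \<sigma> :: _ \<Rightarrow>\<^sub>0 'k)"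
      "\<rho> \<in> Poly_Mapping.keys (carrier_homotopy h n \<omega> :: _ \<Rightarrow>\<^sub>0 'k)"
      using in_keys_lin_ext[OF \<open>\<rho> \<in> Poly_Mapping.keys ?q\<close>] by blast
    note l = keys_bd_simplex_tuples[OF Suc.prems(1) \<omega>(1)]
    show ?thesis using Suc.IH[OF conjunct1[OF l] \<omega>(2)] l by blast
  qed
  obtain \<rho> where \<rho>: "\<tau> = hd \<sigma> # \<rho>" "\<rho> \<in> Poly_Mapping.keys (?p - ?q)"
    using subsetD[OF keys_chain_map Suc.prems(2)[unfolded carrier_homotopy.simps]] by blast
  then have "\<rho> \<in> {map h \<sigma>, \<sigma>} \<or> \<rho> \<in> Poly_Mapping.keys ?q"
    using p Poly_Mapping.keys_diff[of ?p ?q] by blast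
  then have "length \<rho> = Suc (Suc n) \<and> set \<rho> \<subseteq> set \<sigma> \<union> h ` set \<sigma>"
    using q Suc.prems(1) by auto
  moreover have "hd \<sigma> \<in> set \<sigma>" using Suc.prems(1) by (auto simp: length_Suc_conv)
  ultimately show ?case using \<rho>(1) by auto
qed

lemma boundary_boundary_tuples:
  assumes "length \<sigma> = Suc (Suc n)"
  shows "boundary tuples n (bd_simplex tuples (Suc n) \<sigma> :: _ \<Rightarrow>\<^sub>0 'k::field) = 0"
proof (cases n)
  case 0
  then show ?thesis by (simp add: boundary_def)
next
  case (Suc m)
  then show ?thesis
    using simplicial_set.bd_bd[OF simplicial_set_rips, of \<sigma> UNIV "\<lambda>_ _. 0" 0 m] assms
    by (simp add: boundary_eq simplices_tuples)
qed

text \<open>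
  In positive dimension, \<open>z = h \<sigma> - \<sigma> - D (\<partial> \<sigma>)\<close> is a cycle since, by induction,
  \<open>\<partial> (D (\<partial> \<sigma>)) = h (\<partial> \<sigma>) - \<partial> \<sigma> - D (\<partial> (\<partial> \<sigma>))\<close>. In dimension \<open>0\<close>, it is the
  augmentation of \<open>h \<sigma> - \<sigma>\<close> that vanishes.
\<close>

lemma boundary_carrier_homotopy:
  assumes "length \<sigma> = Suc n"
  shows "boundary tuples (Suc n) (carrier_homotopy h n \<sigma> :: _ \<Rightarrow>\<^sub>0 'k::field) =
    Poly_Mapping.single (map h \<sigma>) 1 - Poly_Mapping.single \<sigma> 1
      - (if n = 0 then 0 else lin_ext (carrier_homotopy h (n - 1)) (bd_simplex tuples n \<sigma>))"
  using assms
proof (induction n arbitrary: \<sigma>)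
  case 0
  let ?z = "Poly_Mapping.single (map h \<sigma>) 1 - Poly_Mapping.single \<sigma> 1 :: _ \<Rightarrow>\<^sub>0 'k"
  have "Poly_Mapping.keys ?z \<subseteq> {map h \<sigma>, \<sigma>}" by (rule keys_single_diff)
  then have "Poly_Mapping.keys ?z \<subseteq> simplices tuples 0"
    using 0 by (auto simp: simplices_tuples)
  from boundary_cone[OF this] show ?case by (simp add: chain_map_diff chain_map_single)
next
  case (Suc n)
  let ?p = "Poly_Mapping.single (map h \<sigma>) 1 - Poly_Mapping.single \<sigma> 1 :: _ \<Rightarrow>\<^sub>0 'k"
  let ?b = "bd_simplex tuples (Suc n) \<sigma> :: _ \<Rightarrow>\<^sub>0 'k"
  let ?q = "lin_ext (carrier_homotopy h n) ?b"
  let ?z = "?p - ?q"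
  have p: "Poly_Mapping.keys ?p \<subseteq> {map h \<sigma>, \<sigma>}" by (rule keys_single_diff)
  have "Poly_Mapping.keys ?q \<subseteq> simplices tuples (Suc n)"
  proof
    fix \<rho> assume \<rho>: "\<rho> \<in> Poly_Mapping.keys ?q"
    then obtain \<omega> where "\<omega> \<in> Poly_Mapping.keys ?b"
      "\<rho> \<in> Poly_Mapping.keys (carrier_homotopy h n \<omega> :: _ \<Rightarrow>\<^sub>0 'k)"
      using in_keys_lin_ext[OF \<rho>] by blast
    then have "length \<rho> = Suc (Suc n)"
      using keys_carrier_homotopy keys_bd_simplex_tuples[OF Suc.prems] by blast
    then show "\<rho> \<in> simplices tuples (Suc n)" by (simp add: simplices_tuples)
  qed
  moreover have "{map h \<sigma>, \<sigma>} \<subseteq> simplices tuples (Suc n)"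
    using Suc.prems by (simp add: simplices_tuples)
  ultimately have keys: "Poly_Mapping.keys ?z \<subseteq> simplices tuples (Suc n)"
    using p Poly_Mapping.keys_diff[of ?p ?q] by blast
  let ?D = "\<lambda>\<omega>. if n = 0 then 0 else lin_ext (carrier_homotopy h (n - 1)) (bd_simplex tuples n \<omega>)
    :: _ \<Rightarrow>\<^sub>0 'k"
  have "boundary tuples (Suc n) ?q
      = lin_ext (\<lambda>\<omega>. boundary tuples (Suc n) (carrier_homotopy h n \<omega>)) ?b"
    by (simp add: boundary_eq lin_ext_ext)
  also have "\<dots> = lin_ext (\<lambda>\<omega>. Poly_Mapping.single (map h \<omega>) 1 - Poly_Mapping.single \<omega> 1 - ?D \<omega>) ?b"
    using Suc.IH keys_bd_simplex_tuples[OF Suc.prems] by (intro lin_ext_cong) blast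
  also have "\<dots> = chain_map (map h) ?b - chain_map (\<lambda>y. y) ?b - lin_ext ?D ?b"
    by (simp add: lin_ext_minus_fun chain_map_eq)
  also have "lin_ext ?D ?b = 0"
  proof (cases "n = 0")
    case False
    then have "lin_ext ?D ?b = lin_ext (carrier_homotopy h (n - 1)) (boundary tuples n ?b)"
      by (simp add: boundary_eq lin_ext_ext)
    then show ?thesis by (simp add: boundary_boundary_tuples[OF Suc.prems] lin_ext_zero)
  qed (simp add: lin_ext_const_0)
  finally have "boundary tuples (Suc n) ?z = 0"
    by (simp add: boundary_diff boundary_single bd_simplex_map[OF Suc.prems] chain_map_id)
  with boundary_cone[OF keys, of "hd \<sigma>"] show ?case
    by (simp add: chain_map_eq lin_ext_zero)
qed

text \<open>
  The second hypothesis is contiguity of \<open>h\<close> and the identity, needed in dimension \<open>n + 1\<close> only: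
  on a cycle, the term of the homotopy formula that comes from dimension \<open>n\<close> vanishes.
\<close>

lemma chain_map_diff_in_boundaries:
  fixes z :: "'v list \<Rightarrow>\<^sub>0 'k::field"
  assumes z: "z \<in> cycles (rips V G s) n"
    and carrier: "\<And>\<sigma> \<tau>. \<sigma> \<in> simplices (rips V G s) n \<Longrightarrow> length \<tau> = Suc (Suc n) \<Longrightarrow>
      set \<tau> \<subseteq> set \<sigma> \<union> h ` set \<sigma> \<Longrightarrow> \<tau> \<in> simplices (rips V G t) (Suc n)"
  shows "chain_map (map h) z - z \<in> boundaries (rips V G t) n"
proof -
  let ?c = "lin_ext (carrier_homotopy h n) z"
  let ?D = "\<lambda>\<omega>. if n = 0 then 0 else lin_ext (carrier_homotopy h (n - 1)) (bd_simplex tuples n \<omega>)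
    :: _ \<Rightarrow>\<^sub>0 'k"
  have keys: "Poly_Mapping.keys z \<subseteq> simplices (rips V G s) n"
    and bz: "boundary tuples n z = 0"
    using z by (auto simp: cycles_def chains_def boundary_tuples[of V G s n])
  have len: "length \<sigma> = Suc n" if "\<sigma> \<in> Poly_Mapping.keys z" for \<sigma>
    using that keys simplices_rips_sub[of V G s n] by (auto simp: simplices_tuples)
  have "?c \<in> carrier (chains (rips V G t) (Suc n))"
  proof -
    have "\<tau> \<in> simplices (rips V G t) (Suc n)" if \<tau>: "\<tau> \<in> Poly_Mapping.keys ?c" for \<tau>
    proof -
      obtain \<sigma> where \<sigma>: "\<sigma> \<in> Poly_Mapping.keys z"
        "\<tau> \<in> Poly_Mapping.keys (carrier_homotopy h n \<sigma> :: _ \<Rightarrow>\<^sub>0 'k)"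
        using in_keys_lin_ext[OF \<tau>] by blast
      show ?thesis
        using carrier[of \<sigma> \<tau>] keys_carrier_homotopy[OF len[OF \<sigma>(1)] \<sigma>(2)] \<sigma>(1) keys by blast
    qed
    then show ?thesis by (auto simp: chains_def)
  qed
  moreover have "boundary (rips V G t) (Suc n) ?c = chain_map (map h) z - z"
  proof -
    have "boundary tuples (Suc n) ?c
        = lin_ext (\<lambda>\<omega>. boundary tuples (Suc n) (carrier_homotopy h n \<omega>)) z"
      by (simp add: boundary_eq lin_ext_ext)
    also have "\<dots> = lin_ext (\<lambda>\<omega>. Poly_Mapping.single (map h \<omega>) 1 - Poly_Mapping.single \<omega> 1 - ?D \<omega>) z"
      using len by (intro lin_ext_cong boundary_carrier_homotopy)
    also have "\<dots> = chain_map (map h) z - chain_map (\<lambda>y. y) z - lin_ext ?D z"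
      by (simp add: lin_ext_minus_fun chain_map_eq)
    also have "lin_ext ?D z = 0"
    proof (cases "n = 0")
      case False
      then have "lin_ext ?D z = lin_ext (carrier_homotopy h (n - 1)) (boundary tuples n z)"
        by (simp add: boundary_eq lin_ext_ext)
      then show ?thesis by (simp add: bz lin_ext_zero)
    qed (simp add: lin_ext_const_0)
    finally show ?thesis
      by (simp add: chain_map_id boundary_tuples[of V G t "Suc n"])
  qed
  ultimately show ?thesis unfolding boundaries_def by (metis image_eqI)
qed

section \<open>Maps induced in homology\<close>

definition simplicial_vertex_map ::
    "('v \<Rightarrow> 'w) \<Rightarrow> 'v list sset \<Rightarrow> 'w list sset \<Rightarrow> bool" where
  "simplicial_vertex_map f X Y \<longleftrightarrow> (\<forall>n. map f ` simplices X n \<subseteq> simplices Y n)"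

lemma chain_map_chains:
  assumes "simplicial_vertex_map f X Y" "c \<in> carrier (chains X n)"
  shows "chain_map (map f) c \<in> carrier (chains Y n)"
  using assms keys_chain_map[of "map f" c]
  by (fastforce simp: simplicial_vertex_map_def chains_def)

lemma boundary_chain_map_rips:
  assumes "c \<in> carrier (chains (rips V G s) n)"
  shows "boundary (rips W G' t) n (chain_map (map f) c)
    = chain_map (map f) (boundary (rips V G s) n c)"
  unfolding boundary_tuples[of W G' t n] boundary_tuples[of V G s n]
  using assms simplices_rips_sub[of V G s n] by (intro boundary_chain_map) (auto simp: chains_def)

lemma chain_map_cycles:
  assumes "simplicial_vertex_map f (rips V G s) (rips W G' t)" "c \<in> cycles (rips V G s) n"
  shows "chain_map (map f) c \<in> cycles (rips W G' t) n"
  using assms chain_map_chains[OF assms(1), of c n] boundary_chain_map_rips[of c V G s n W G' t f]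
  by (auto simp: cycles_def chain_map_eq lin_ext_zero)

lemma chain_map_boundaries:
  assumes "simplicial_vertex_map f (rips V G s) (rips W G' t)" "c \<in> boundaries (rips V G s) n"
  shows "chain_map (map f) c \<in> boundaries (rips W G' t) n"
proof -
  obtain b where b: "b \<in> carrier (chains (rips V G s) (Suc n))" "c = boundary (rips V G s) (Suc n) b"
    using assms(2) by (auto simp: boundaries_def)
  show ?thesis
    unfolding boundaries_def b(2)
    by (rule image_eqI, rule boundary_chain_map_rips[OF b(1), symmetric])
       (rule chain_map_chains[OF assms(1) b(1)])
qed

lemma homology_map_bcoset:
  assumes "simplicial_vertex_map f (rips V G s) (rips W G' t)"
  shows "homology_map (rips W G' t) n (map f) (bcoset (boundaries (rips V G s) n) z)
    = bcoset (boundaries (rips W G' t) n) (chain_map (map f) z)"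
  unfolding homology_map_def coset_chains
  by (rule UN_bcoset[OF subspace_set_boundaries subspace_set_boundaries])
     (use chain_map_boundaries[OF assms] chain_map_diff in metis)

lemma carrier_rips_homology:
  "carrier (pspace (rips_homology K n V G) t) = bcoset (boundaries (rips V G t) n) ` cycles (rips V G t) n"
  by (simp add: rips_homology_def homology_def quot_simps[OF subspace_set_boundaries])

lemma pmap_rips_homology:
  "s \<le> t \<Longrightarrow> pmap (rips_homology K n V G) s t (bcoset (boundaries (rips V G s) n) z)
    = bcoset (boundaries (rips V G t) n) z"
  by (simp add: rips_homology_def homology_map_rips)

lemma linear_map_homology_map:
  assumes f: "simplicial_vertex_map f (rips V G s) (rips W G' t)"
  shows "linear_map class_ring (pspace (rips_homology K n V G) s) (pspace (rips_homology K n W G') t)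
    (homology_map (rips W G' t) n (map f))"
proof -
  have "homology_map (rips W G' t) n (map f) \<in> LinearCombinations.module_hom class_ring
      (pspace (rips_homology K n V G) s) (pspace (rips_homology K n W G') t)"
    by (auto intro!: imageI chain_map_cycles[OF f] simp: module_hom_def rips_homology_def homology_def quot_simps[OF subspace_set_boundaries]
        homology_map_bcoset[OF f] chain_map_add chain_map_scale)
  then show ?thesis
    using vectorspace_rips_homology[of K n V G] vectorspace_rips_homology[of K n W G']
    by (intro linear_map.intro mod_hom.intro mod_hom_axioms.intro vectorspace.axioms(1))
qed

lemma L_le_add: "(t::L) \<le> t + \<delta>"
  by (auto simp: less_eq_prod_def)

lemma L_add_right_mono: "(s::L) \<le> t \<Longrightarrow> s + \<delta> \<le> t + \<delta>"
  by (auto simp: less_eq_prod_def intro: add_right_mono)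

lemma pers_hom_homology_map:
  assumes f: "\<And>t. simplicial_vertex_map f (rips V G t) (rips W G' (t + \<delta>))"
  shows "pers_hom \<delta> (rips_homology K n V G) (rips_homology K n W G')
    (\<lambda>t. homology_map (rips W G' (t + \<delta>)) n (map f))"
  unfolding pers_hom_def
proof (intro conjI allI impI ballI)
  fix s t :: L and x assume st: "s \<le> t" and "x \<in> carrier (pspace (rips_homology K n V G) s)"
  then obtain z where x: "x = bcoset (boundaries (rips V G s) n) z"
    by (auto simp: carrier_rips_homology)
  have "s + \<delta> \<le> t + \<delta>" using st by (rule L_add_right_mono)
  then show "homology_map (rips W G' (t + \<delta>)) n (map f) (pmap (rips_homology K n V G) s t x) =
      pmap (rips_homology K n W G') (s + \<delta>) (t + \<delta>) (homology_map (rips W G' (s + \<delta>)) n (map f) x)"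
    by (simp add: x pmap_rips_homology[OF st] homology_map_bcoset[OF f] pmap_rips_homology)
qed (rule linear_map_homology_map[OF f])

section \<open>The interleaving\<close>

lemma simplicial_vertex_map_rips:
  assumes "extended_metric_on V d" "extended_metric_on W d'" "f ` V \<subseteq> W"
    and "\<And>u v. u \<in> V \<Longrightarrow> v \<in> V \<Longrightarrow>
      function_graph d' \<gamma>' (f u) (f v) \<le> function_graph d \<gamma> u v + \<delta>"
  shows "simplicial_vertex_map f (rips V (function_graph d \<gamma>) t)
    (rips W (function_graph d' \<gamma>') (t + \<delta>))"
proof -
  have "function_graph d' \<gamma>' (f u) (f v) \<le> t + \<delta>"
    if "function_graph d \<gamma> u v \<le> t" "u \<in> V" "v \<in> V" for u v
    using order_trans[OF assms(4)[OF that(2,3)] L_add_right_mono[OF that(1)]] .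
  then show ?thesis
    using assms(3)
    by (auto simp: simplicial_vertex_map_def simplices_rips_function_graph[OF assms(1)]
        simplices_rips_function_graph[OF assms(2)] subset_iff image_subset_iff)
qed

text \<open>
  Both \<open>(u, f u)\<close> and \<open>(g (f u), f u)\<close> lie in \<open>C\<close>. Two points of \<open>set \<sigma> \<union> (g \<circ> f) ` set \<sigma>\<close> can
  therefore be exchanged for points of \<open>set \<sigma>\<close> with the same partners in \<open>W\<close>, by passing to \<open>W\<close>
  and back at a cost of \<open>\<delta>\<close> each way.
\<close>

lemma homology_map_roundtrip:
  fixes K :: "'k::field itself"
  assumes d: "extended_metric_on V d" and d': "extended_metric_on W d'"
    and C: "C \<subseteq> V \<times> W"
    and f: "\<And>v. v \<in> V \<Longrightarrow> (v, f v) \<in> C" and g: "\<And>w. w \<in> W \<Longrightarrow> (g w, w) \<in> C"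
    and up: "\<And>v w v' w'. (v, w) \<in> C \<Longrightarrow> (v', w') \<in> C \<Longrightarrow>
      function_graph d' \<gamma>' w w' \<le> function_graph d \<gamma> v v' + \<delta>"
    and down: "\<And>v w v' w'. (v, w) \<in> C \<Longrightarrow> (v', w') \<in> C \<Longrightarrow>
      function_graph d \<gamma> v v' \<le> function_graph d' \<gamma>' w w' + \<delta>"
    and x: "x \<in> carrier (pspace (rips_homology K n V (function_graph d \<gamma>)) t)"
  shows "homology_map (rips V (function_graph d \<gamma>) (t + \<delta> + \<delta>)) n (map g)
      (homology_map (rips W (function_graph d' \<gamma>') (t + \<delta>)) n (map f) x)
    = pmap (rips_homology K n V (function_graph d \<gamma>)) t (t + \<delta> + \<delta>) x"
proof -
  let ?G = "function_graph d \<gamma>" and ?G' = "function_graph d' \<gamma>'"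
  have fW: "f ` V \<subseteq> W" and gV: "g ` W \<subseteq> V" using C f g by auto
  have sf: "simplicial_vertex_map f (rips V ?G t) (rips W ?G' (t + \<delta>))"
    by (rule simplicial_vertex_map_rips[OF d d' fW up[OF f f]])
  have sg: "simplicial_vertex_map g (rips W ?G' (t + \<delta>)) (rips V ?G (t + \<delta> + \<delta>))"
    by (rule simplicial_vertex_map_rips[OF d' d gV down[OF g g]])
  obtain z where z: "z \<in> cycles (rips V ?G t) n" "x = bcoset (boundaries (rips V ?G t) n) z"
    using x by (auto simp: carrier_rips_homology)
  have "chain_map (map (g \<circ> f)) z - z \<in> boundaries (rips V ?G (t + \<delta> + \<delta>)) n"
  proof (rule chain_map_diff_in_boundaries[OF z(1)])
    fix \<sigma> \<tau> assume \<sigma>: "\<sigma> \<in> simplices (rips V ?G t) n"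
      and \<tau>: "length \<tau> = Suc (Suc n)" "set \<tau> \<subseteq> set \<sigma> \<union> (g \<circ> f) ` set \<sigma>"
    have \<sigma>V: "set \<sigma> \<subseteq> V" and \<sigma>t: "\<And>u v. u \<in> set \<sigma> \<Longrightarrow> v \<in> set \<sigma> \<Longrightarrow> ?G u v \<le> t"
      using \<sigma> by (auto simp: simplices_rips_function_graph[OF d])
    have partner: "\<exists>u\<in>set \<sigma>. (a, f u) \<in> C" if "a \<in> set \<tau>" for a
    proof -
      have "a \<in> set \<sigma> \<union> (g \<circ> f) ` set \<sigma>" using that \<tau>(2) by blast
      then consider "a \<in> set \<sigma>" | u where "u \<in> set \<sigma>" "a = g (f u)" by auto
      then show ?thesis
      proof cases
        case 1
        then show ?thesis using f \<sigma>V by blast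
      next
        case 2
        then have "f u \<in> W" using \<sigma>V fW by blast
        then show ?thesis using g 2 by blast
      qed
    qed
    have "?G a b \<le> t + \<delta> + \<delta>" if ab: "a \<in> set \<tau>" "b \<in> set \<tau>" for a b
    proof -
      obtain u v where uv: "u \<in> set \<sigma>" "v \<in> set \<sigma>" "(a, f u) \<in> C" "(b, f v) \<in> C"
        using partner ab by blast
      have "?G a b \<le> ?G' (f u) (f v) + \<delta>" using down uv by blast
      moreover have "?G' (f u) (f v) \<le> ?G u v + \<delta>" using up f uv \<sigma>V by blast
      moreover have "?G u v \<le> t" using \<sigma>t uv by blast
      ultimately show ?thesis
        by (meson L_add_right_mono order_trans)
    qed
    moreover have "set \<tau> \<subseteq> V" using partner C by blast
    ultimately show "\<tau> \<in> simplices (rips V ?G (t + \<delta> + \<delta>)) (Suc n)"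
      using \<tau>(1) by (auto simp: simplices_rips_function_graph[OF d])
  qed
  then have "bcoset (boundaries (rips V ?G (t + \<delta> + \<delta>)) n) (chain_map (map (g \<circ> f)) z)
      = bcoset (boundaries (rips V ?G (t + \<delta> + \<delta>)) n) z"
    by (simp add: bcoset_eq[OF subspace_set_boundaries])
  moreover have "t \<le> t + \<delta> + \<delta>" using L_le_add order_trans by blast
  ultimately show ?thesis
    by (simp add: z(2) homology_map_bcoset[OF sf] homology_map_bcoset[OF sg] pmap_rips_homology
        chain_map_comp)
qed

lemma interleaved_correspondence:
  assumes d: "extended_metric_on V d" and d': "extended_metric_on W d'"
    and C: "C \<in> correspondences V W"
    and up: "\<And>v w v' w'. (v, w) \<in> C \<Longrightarrow> (v', w') \<in> C \<Longrightarrow>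
      function_graph d' \<gamma>' w w' \<le> function_graph d \<gamma> v v' + \<delta>"
    and down: "\<And>v w v' w'. (v, w) \<in> C \<Longrightarrow> (v', w') \<in> C \<Longrightarrow>
      function_graph d \<gamma> v v' \<le> function_graph d' \<gamma>' w w' + \<delta>"
  shows "interleaved \<delta> (rips_homology K n V (function_graph d \<gamma>))
    (rips_homology K n W (function_graph d' \<gamma>'))"
proof -
  let ?G = "function_graph d \<gamma>" and ?G' = "function_graph d' \<gamma>'"
  have sub: "C \<subseteq> V \<times> W" and "fst ` C = V" "snd ` C = W"
    using C by (auto simp: correspondences_def)
  then have "\<forall>v\<in>V. \<exists>w. (v, w) \<in> C" "\<forall>w\<in>W. \<exists>v. (v, w) \<in> C" by force+
  then obtain f g where f: "\<And>v. v \<in> V \<Longrightarrow> (v, f v) \<in> C" and g: "\<And>w. w \<in> W \<Longrightarrow> (g w, w) \<in> C"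
    by metis
  have fW: "f ` V \<subseteq> W" and gV: "g ` W \<subseteq> V" using sub f g by auto
  have sub': "C\<inverse> \<subseteq> W \<times> V" using sub by auto
  have F: "pers_hom \<delta> (rips_homology K n V ?G) (rips_homology K n W ?G')
      (\<lambda>t. homology_map (rips W ?G' (t + \<delta>)) n (map f))"
    by (rule pers_hom_homology_map, rule simplicial_vertex_map_rips[OF d d' fW up[OF f f]])
  have G: "pers_hom \<delta> (rips_homology K n W ?G') (rips_homology K n V ?G)
      (\<lambda>t. homology_map (rips V ?G (t + \<delta>)) n (map g))"
    by (rule pers_hom_homology_map, rule simplicial_vertex_map_rips[OF d' d gV down[OF g g]])
  show ?thesis
    unfolding interleaved_def
  proof (intro exI conjI allI ballI)
    show "homology_map (rips V ?G (t + \<delta> + \<delta>)) n (map g) (homology_map (rips W ?G' (t + \<delta>)) n (map f) x)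
        = pmap (rips_homology K n V ?G) t (t + \<delta> + \<delta>) x"
      if "x \<in> carrier (pspace (rips_homology K n V ?G) t)" for t x
      by (rule homology_map_roundtrip[OF d d' sub f g up down that])
    show "homology_map (rips W ?G' (t + \<delta> + \<delta>)) n (map f) (homology_map (rips V ?G (t + \<delta>)) n (map g) x)
        = pmap (rips_homology K n W ?G') t (t + \<delta> + \<delta>) x"
      if "x \<in> carrier (pspace (rips_homology K n W ?G') t)" for t x
      by (rule homology_map_roundtrip[OF d' d sub' _ _ _ _ that]) (use f g up down in auto)
  qed (rule F G)+
qed

theorem mainTheorem5:
  fixes V1 :: "'v set" and V2 :: "'w set"
    and d1 :: "'v \<Rightarrow> 'v \<Rightarrow> ennreal" and d2 :: "'w \<Rightarrow> 'w \<Rightarrow> ennreal"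
    and \<gamma>1 :: "'v \<Rightarrow> ennreal" and \<gamma>2 :: "'w \<Rightarrow> ennreal"
    and K :: "'k::field itself"
  assumes "finite V1" "extended_metric_on V1 d1"
    and "finite V2" "extended_metric_on V2 d2"
  shows "network_dist V1 (function_graph d1 \<gamma>1) V2 (function_graph d2 \<gamma>2) =
      (INF C \<in> correspondences V1 V2.
         max (SUP ((v1, v2), (v1', v2')) \<in> C \<times> C. absdiff (d1 v1 v1') (d2 v2 v2'))
             (SUP (v1, v2) \<in> C. absdiff (\<gamma>1 v1) (\<gamma>2 v2))) \<and>
    (\<forall>n. interleaving_dist (rips_homology K n V1 (function_graph d1 \<gamma>1))
                           (rips_homology K n V2 (function_graph d2 \<gamma>2))
          \<le> network_dist V1 (function_graph d1 \<gamma>1) V2 (function_graph d2 \<gamma>2))"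
proof (intro conjI allI)
  show "network_dist V1 (function_graph d1 \<gamma>1) V2 (function_graph d2 \<gamma>2) =
      (INF C \<in> correspondences V1 V2.
         max (SUP ((v1, v2), (v1', v2')) \<in> C \<times> C. absdiff (d1 v1 v1') (d2 v2 v2'))
             (SUP (v1, v2) \<in> C. absdiff (\<gamma>1 v1) (\<gamma>2 v2)))"
    unfolding network_dist_def sup_coords_delta_plus ..
next
  fix n
  show "interleaving_dist (rips_homology K n V1 (function_graph d1 \<gamma>1))
      (rips_homology K n V2 (function_graph d2 \<gamma>2))
    \<le> network_dist V1 (function_graph d1 \<gamma>1) V2 (function_graph d2 \<gamma>2)"
    unfolding network_dist_def interleaving_dist_def
    by (intro INF_greatest Inf_lower CollectI
        interleaved_correspondence[OF assms(2,4) _ correspondence_distortion])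
qed

end
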